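(* Let $n\ge 2$ and let $F\subsetneq\mathbb{C}^n$ be a proper convex closed subset of $\mathbb{C}^n$. Then the following statements are equivalent: (i) either $F$ is a complex hyperplane or $F$ does not contain any complex hyperplane; (ii) for any integer $k\ge 1$ and any two sets of $k$ pairwise distinct points $\{\alpha_1,\alpha_2,\dots,\alpha_k\}\subset\mathbb{C}$ and $\{a_1,a_2,\dots,a_k\}\subset\mathbb{C}^n\setminus F$, there exists a proper holomorphic embedding $\varphi:\mathbb{C}\to\mathbb{C}^n$ such that $\varphi(\alpha_j)=a_j$ for $1\le j\le k$ and $\varphi(\mathbb{C})\subset\mathbb{C}^n\setminus F$; (iii) for any two sets of two distinct points $\{\alpha_1,\alpha_2\}\subset\mathbb{C}$ and $\{a_1,a_2\}\subset\mathbb{C}^n\setminus F$, there exists a proper holomorphic embedding $\varphi:\mathbb{C}\to\mathbb{C}^n$ such that $\varphi(\alpha_j)=a_j$ for $j=1,2$ and $\varphi(\mathbb{C})\subset\mathbb{C}^n\setminus F$.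
   Context: A complex hyperplane in $\mathbb{C}^n$ is an affine complex subspace of complex dimension $n-1$ (not necessarily through the origin). A proper holomorphic embedding $\varphi:\mathbb{C}\to\mathbb{C}^n$ is an injective holomorphic immersion which is a proper map (preimages of compact sets are compact). *)

theory Defs
  imports "HOL-Analysis.Analysis"
begin

text \<open>
  \<open>vec.subspace\<close> and \<open>vec.dim\<close> refer to the scalar multiplication \<open>(*s)\<close>, so here they mean
  complex subspaces and complex dimension; the unqualified \<open>subspace\<close>, \<open>affine\<close>, \<open>dim\<close> and
  \<open>aff_dim\<close> would be the real notions.
\<close>

definition complex_hyperplane :: "(complex ^ 'n) set \<Rightarrow> bool" where
  "complex_hyperplane H \<longleftrightarrow>
     (\<exists>a V. vec.subspace V \<and> vec.dim V + 1 = CARD('n) \<and> H = (\<lambda>v. a + v) ` V)"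

definition proper_holomorphic_embedding :: "(complex \<Rightarrow> complex ^ 'n) \<Rightarrow> bool" where
  "proper_holomorphic_embedding \<phi> \<longleftrightarrow>
     inj \<phi> \<and>
     (\<forall>i. (\<lambda>z. \<phi> z $ i) holomorphic_on UNIV) \<and>
     (\<forall>z. (\<chi> i. deriv (\<lambda>w. \<phi> w $ i) z) \<noteq> 0) \<and>
     (\<forall>K. compact K \<longrightarrow> compact (\<phi> -` K))"

end

theory Submission
  imports Defs "HOL-Complex_Analysis.Great_Picard" "HOL-Real_Asymp.Real_Asymp"
begin

text \<open>
  If \<open>F\<close> contains a complex hyperplane \<open>{l = r}\<close> but is not one, then \<open>F\<close> is invariant under
  \<open>ker l\<close>, so \<open>l \<circ> \<phi>\<close> omits two values for every entire \<open>\<phi>\<close> avoiding \<open>F\<close>; it is constant by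
  Picard's little theorem, and \<open>\<phi>\<close> cannot join two points with different values of \<open>l\<close>.

  For the converse, start from an explicit curve and move its points to the prescribed ones by
  automorphisms. If \<open>F\<close> is a hyperplane \<open>{l = r}\<close>, shears \<open>x + G (l x)\<close> with \<open>G\<close> valued in \<open>ker l\<close>
  and one overshear, all preserving \<open>F\<close>, carry \<open>z k + (r + exp (t z)) e\<close> to the given points. If
  \<open>F\<close> contains no hyperplane, then there are two linearly independent complex functionals \<open>l1\<close>,
  \<open>l2\<close> with real parts bounded above on \<open>F\<close>, and only finitely many half spaces containing \<open>F\<close>
  are needed to separate \<open>F\<close> from the given points. A shear \<open>x + G (l x)\<close> with \<open>G\<close> tiny on the
  half plane \<open>Re w \<le> c\<close> almost fixes \<open>F\<close>, so it costs only a small enlargement of the half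
  spaces, while \<open>G\<close> can be prescribed at finitely many points with \<open>Re w > c\<close>. Such shears push
  the given points out of \<open>{Re l1 \<le> c1, Re l2 \<le> c2}\<close> and then onto the complex hyperplane
  \<open>{l1 + l2 = 2 R}\<close>, which does not meet this set for large \<open>R\<close>.
\<close>

section \<open>Linear functionals and interpolation\<close>

text \<open>No conjugation is involved, so \<open>cdot l\<close> is complex linear and preserves
  holomorphy; every complex functional has this form.\<close>

definition cdot :: "complex ^ 'n \<Rightarrow> complex ^ 'n \<Rightarrow> complex" where
  "cdot l x = (\<Sum>i\<in>UNIV. l $ i * x $ i)"

lemma cdot_simps [simp]:
  "cdot l (x + y) = cdot l x + cdot l y"
  "cdot l (x - y) = cdot l x - cdot l y"
  "cdot l (- x) = - cdot l x"
  "cdot l (s *s x) = s * cdot l x"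
  "cdot l 0 = 0"
  "cdot (l + m) x = cdot l x + cdot m x"
  "cdot (s *s l) x = s * cdot l x"
  "cdot 0 x = 0"
  by (simp_all add: cdot_def algebra_simps sum.distrib sum_subtractf sum_negf sum_distrib_left)

lemma cdot_sum [simp]: "cdot l (\<Sum>j\<in>A. f j) = (\<Sum>j\<in>A. cdot l (f j))"
  by (induction A rule: infinite_finite_induct) auto

lemma cdot_axis [simp]: "cdot (axis i 1) x = x $ i" "cdot l (axis i 1) = l $ i"
  by (simp_all add: cdot_def axis_def if_distrib if_distribR cong: if_cong)

lemma norm_cdot_le: "norm (cdot l x) \<le> (\<Sum>i\<in>UNIV. norm (l $ i)) * norm x"
proof -
  have "norm (cdot l x) \<le> (\<Sum>i\<in>UNIV. norm (l $ i * x $ i))"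
    unfolding cdot_def by (rule norm_sum)
  also have "\<dots> \<le> (\<Sum>i\<in>UNIV. norm (l $ i) * norm x)"
    by (intro sum_mono) (simp add: norm_mult mult_left_mono Finite_Cartesian_Product.norm_nth_le)
  finally show ?thesis by (simp add: sum_distrib_right)
qed

lemma continuous_on_cdot [continuous_intros]:
  "continuous_on S f \<Longrightarrow> continuous_on S (\<lambda>x. cdot l (f x))"
  unfolding cdot_def by (intro continuous_intros)

lemma holomorphic_on_cdot:
  "(\<And>i. (\<lambda>z. f z $ i) holomorphic_on S) \<Longrightarrow> (\<lambda>z. cdot l (f z)) holomorphic_on S"
  unfolding cdot_def by (intro holomorphic_intros) auto

lemma DERIV_cdot_0:
  "(\<And>i. ((\<lambda>z. f z $ i) has_field_derivative 0) (at z)) \<Longrightarrow>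
     ((\<lambda>z. cdot l (f z)) has_field_derivative 0) (at z)"
  unfolding cdot_def
  by (rule DERIV_cong[OF DERIV_sum]) (auto intro!: DERIV_cmult[where D=0])

lemma cdot_ne_0_exists:
  assumes "x \<noteq> 0" shows "\<exists>l. cdot l x \<noteq> 0"
proof -
  obtain i where "x $ i \<noteq> 0" using assms by (auto simp: vec_eq_iff)
  then show ?thesis by (intro exI[of _ "axis i 1"]) simp
qed

text \<open>Replace \<open>m\<close> by \<open>m + t *s l\<close>. A vector on which
  \<open>l\<close> does not vanish excludes a single \<open>t\<close>; a vector killed by
  \<open>l\<close> keeps its nonzero value under \<open>m\<close>.\<close>

lemma generic_functional:
  assumes "finite D" "\<And>d. d \<in> D \<Longrightarrow> d \<noteq> 0"
  shows "\<exists>m. \<forall>d\<in>D. cdot m d \<noteq> 0"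
  using assms
proof (induction D)
  case (insert d D)
  then obtain m where m: "\<forall>d\<in>D. cdot m d \<noteq> 0" by auto
  obtain l where l: "cdot l d \<noteq> 0" using insert.prems cdot_ne_0_exists by blast
  have "finite ((\<lambda>d. - cdot m d / cdot l d) ` insert d D \<union> {0})" using insert by simp
  then obtain t where t: "t \<notin> (\<lambda>d. - cdot m d / cdot l d) ` insert d D \<union> {0}"
    using ex_new_if_finite infinite_UNIV_char_0 by blast
  have "cdot (m + t *s l) d' \<noteq> 0" if "d' \<in> insert d D" for d'
  proof
    assume "cdot (m + t *s l) d' = 0"
    then have eq: "t * cdot l d' = - cdot m d'" by (simp add: eq_neg_iff_add_eq_0 add.commute)
    show False
    proof (cases "cdot l d' = 0")
      case True
      then show False using eq m l that by auto
    next
      case False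
      then have "t = - cdot m d' / cdot l d'" using eq by (simp add: field_simps)
      then show False using t that by blast
    qed
  qed
  then show ?case by blast
qed auto

text \<open>A small \<open>t\<close> brings the finite set into the strip of imaginary parts below
  pi in modulus, where \<open>exp\<close> is injective.\<close>

lemma exp_scaled_inj_on:
  assumes "finite (W :: complex set)"
  shows "\<exists>t>0. inj_on (\<lambda>w. exp (of_real t * w)) W"
proof -
  obtain B where B: "\<And>w. w \<in> W \<Longrightarrow> norm w \<le> B"
    using finite_imp_bounded[OF assms] bounded_iff by blast
  define t where "t = 1 / (\<bar>B\<bar> + 1)"
  have t: "t > 0" unfolding t_def by auto
  have im: "\<bar>Im (of_real t * w)\<bar> < pi" if "w \<in> W" for w
  proof -
    have "\<bar>Im (of_real t * w)\<bar> \<le> t * norm w"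
      using t abs_Im_le_cmod[of w] by (simp add: abs_mult)
    also have "\<dots> \<le> t * (\<bar>B\<bar> + 1)" using B[OF that] t by (intro mult_left_mono) auto
    also have "\<dots> = 1" unfolding t_def by (simp add: field_simps)
    also have "\<dots> < pi" using pi_gt3 by simp
    finally show ?thesis .
  qed
  have "inj_on (\<lambda>w. exp (of_real t * w)) W"
  proof (rule inj_onI)
    fix x y assume xy: "x \<in> W" "y \<in> W" "exp (of_real t * x) = exp (of_real t * y)"
    have "of_real t * x = of_real t * y"
    proof (rule exp_complex_eqI[OF _ xy(3)])
      show "\<bar>Im (of_real t * x) - Im (of_real t * y)\<bar> < 2 * pi"
        using im[OF xy(1)] im[OF xy(2)] by linarith
    qed
    then show "x = y" using t by simp
  qed
  with t show ?thesis by blast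
qed

lemma entire_cardinal_function:
  assumes "finite W" "w0 \<in> W" "Re w0 > c" "e > 0"
  shows "\<exists>g. g holomorphic_on UNIV \<and> (\<forall>w\<in>W. g w = (if w = w0 then 1 else 0)) \<and>
           (\<forall>w. Re w \<le> c \<longrightarrow> norm (g w) \<le> e)"
proof -
  obtain t where t: "t > 0" "inj_on (\<lambda>w. exp (of_real t * w)) W"
    using exp_scaled_inj_on[OF assms(1)] by blast
  define E where "E w = exp (of_real t * w)" for w :: complex
  define C where "C = exp (t * c)"
  \<comment> \<open>On the half plane \<open>Re w \<le> c\<close> the modulus of \<open>E w\<close>
    is at most \<open>C\<close>, so \<open>B\<close> bounds the Lagrange product there. The extra
    factor, equal to 1 at \<open>w0\<close>, has modulus at most
    \<open>exp (- s * (Re w0 - c))\<close> there, which a large \<open>s\<close> makes small against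
    \<open>B\<close>.\<close>
  define B where "B = (\<Prod>w\<in>W - {w0}. (C + norm (E w)) / norm (E w0 - E w))"
  have B: "B \<ge> 0" unfolding B_def C_def by (intro prod_nonneg) auto
  have "((\<lambda>s. B * exp (- s * (Re w0 - c))) \<longlongrightarrow> 0) at_top"
    using assms(3) by real_asymp
  then have "eventually (\<lambda>s. B * exp (- s * (Re w0 - c)) < e) at_top"
    using assms(4) order_tendstoD(2) by blast
  then have "eventually (\<lambda>s. B * exp (- s * (Re w0 - c)) < e \<and> s > 0) at_top"
    using eventually_gt_at_top[of 0] by eventually_elim auto
  then obtain s where s: "B * exp (- s * (Re w0 - c)) < e" "s > 0"
    using eventually_happens'[OF trivial_limit_at_top_linorder] by fast
  \<comment> \<open>A Lagrange polynomial in \<open>exp (t w)\<close> is bounded on left half planes; the extra exponential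
    factor makes it small there.\<close>
  define g where "g w = exp (of_real s * (w - w0)) *
     (\<Prod>v\<in>W - {w0}. (E w - E v) / (E w0 - E v))" for w
  have ne: "E w0 - E v \<noteq> 0" if "v \<in> W - {w0}" for v
    using inj_onD[OF t(2), of w0 v] that assms(2) unfolding E_def by (metis DiffE eq_iff_diff_eq_0 singletonI)
  have "g holomorphic_on UNIV"
    unfolding g_def E_def by (intro holomorphic_intros) (use ne in \<open>simp_all add: E_def\<close>)
  moreover have "g w = (if w = w0 then 1 else 0)" if "w \<in> W" for w
  proof (cases "w = w0")
    case True
    then show ?thesis using ne by (simp add: g_def)
  next
    case False
    then show ?thesis using that assms(1) by (auto simp: g_def)
  qed
  moreover have "norm (g w) \<le> e" if "Re w \<le> c" for w
  proof -
    have "norm (E w) \<le> C" using that t by (simp add: E_def C_def)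
    then have "norm (E w - E v) \<le> C + norm (E v)" for v
      using norm_triangle_ineq4[of "E w" "E v"] by linarith
    then have "norm (\<Prod>v\<in>W - {w0}. (E w - E v) / (E w0 - E v)) \<le> B"
      unfolding B_def prod_norm[symmetric] norm_divide
      by (intro prod_mono) (auto intro!: divide_right_mono)
    moreover have "norm (exp (of_real s * (w - w0))) \<le> exp (- s * (Re w0 - c))"
    proof -
      have "s * (Re w - Re w0) \<le> - s * (Re w0 - c)"
        using that s(2) by (simp add: algebra_simps)
      then show ?thesis by simp
    qed
    ultimately have "norm (g w) \<le> exp (- s * (Re w0 - c)) * B"
      unfolding g_def norm_mult by (intro mult_mono) auto
    then show ?thesis using s(1) by (simp add: mult.commute)
  qed
  ultimately show ?thesis by blast
qed

text \<open>\<open>G\<close> is a combination of the prescribed values with cardinal functions as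
  coefficients. Hence a functional that kills all values kills \<open>G\<close>: this is the last
  clause, which later tells which functionals a shear preserves. Nodes in the left half plane carry
  the value 0 and need no term.\<close>

lemma entire_interpolation:
  fixes d :: "'a \<Rightarrow> complex ^ 'n" and p :: "'a \<Rightarrow> complex"
  assumes "finite A" "e > 0"
    and cons: "\<And>w w'. w \<in> A \<Longrightarrow> w' \<in> A \<Longrightarrow> p w = p w' \<Longrightarrow> d w = d w'"
    and zero: "\<And>w. w \<in> A \<Longrightarrow> Re (p w) \<le> c \<Longrightarrow> d w = 0"
  shows "\<exists>G. (\<forall>i. (\<lambda>z. G z $ i) holomorphic_on UNIV) \<and> (\<forall>w\<in>A. G (p w) = d w) \<and>
           (\<forall>z. Re z \<le> c \<longrightarrow> norm (G z) \<le> e) \<and>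
           (\<forall>l. (\<forall>w\<in>A. cdot l (d w) = 0) \<longrightarrow> (\<forall>z. cdot l (G z) = 0))"
proof -
  define W where "W = p ` A"
  define V where "V = {w \<in> W. Re w > c}"
  define h where "h v = d (inv_into A p v)" for v
  have fin: "finite W" "finite V" using assms(1) by (auto simp: W_def V_def)
  have iA: "inv_into A p v \<in> A" if "v \<in> W" for v
    using that unfolding W_def by (rule inv_into_into)
  have h: "h (p w) = d w" if "w \<in> A" for w
    unfolding h_def using that by (intro cons iA) (auto simp: W_def f_inv_into_f)
  \<comment> \<open>With every cardinal function bounded by \<open>e / M\<close>, the sum has norm
    at most \<open>e * (M - 1) / M\<close>; the summand 1 keeps \<open>M\<close> positive when
    \<open>V\<close> is empty.\<close>
  define M where "M = (\<Sum>v\<in>V. norm (h v)) + 1"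
  have M: "M > 0" unfolding M_def by (smt (verit) norm_ge_zero sum_nonneg)
  have "\<forall>v. \<exists>g. v \<in> V \<longrightarrow> g holomorphic_on UNIV \<and> (\<forall>w\<in>W. g w = (if w = v then 1 else 0)) \<and>
           (\<forall>w. Re w \<le> c \<longrightarrow> norm (g w) \<le> e / M)"
    using entire_cardinal_function[OF fin(1), of _ c "e / M"] assms(2) M by (auto simp: V_def)
  then obtain g where g: "\<And>v. v \<in> V \<Longrightarrow> g v holomorphic_on UNIV"
     "\<And>v w. v \<in> V \<Longrightarrow> w \<in> W \<Longrightarrow> g v w = (if w = v then 1 else 0)"
     "\<And>v w. v \<in> V \<Longrightarrow> Re w \<le> c \<Longrightarrow> norm (g v w) \<le> e / M"
    by metis
  define G where "G z = (\<Sum>v\<in>V. g v z *s h v)" for z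
  have "(\<lambda>z. G z $ i) holomorphic_on UNIV" for i
    unfolding G_def by (auto intro!: holomorphic_intros g)
  moreover have "G (p w) = d w" if w: "w \<in> A" for w
  proof -
    have "G (p w) = (\<Sum>v\<in>V. if v = p w then h v else 0)"
      unfolding G_def by (intro sum.cong) (use w in \<open>auto simp: g W_def\<close>)
    also have "\<dots> = d w"
      using w zero[OF w] fin by (auto simp: h V_def W_def)
    finally show ?thesis .
  qed
  moreover have "norm (G z) \<le> e" if "Re z \<le> c" for z
  proof -
    have nsm: "norm (s *s x) = norm s * norm x" for s :: complex and x :: "complex ^ 'n"
      by (simp add: norm_vec_def L2_set_def norm_mult power_mult_distrib
          sum_distrib_left[symmetric] real_sqrt_mult)
    have "norm (G z) \<le> (\<Sum>v\<in>V. norm (g v z *s h v))" unfolding G_def by (rule norm_sum)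
    also have "\<dots> \<le> (\<Sum>v\<in>V. e / M * norm (h v))"
      unfolding nsm by (intro sum_mono mult_right_mono g that norm_ge_zero)
    also have "\<dots> = e / M * (M - 1)" by (simp add: M_def sum_distrib_left)
    also have "\<dots> \<le> e" using M assms(2) by (simp add: field_simps)
    finally show ?thesis .
  qed
  moreover have "cdot l (G z) = 0" if "\<forall>w\<in>A. cdot l (d w) = 0" for l z
    using that iA unfolding G_def h_def V_def by auto
  ultimately show ?thesis by blast
qed

section \<open>Shears and overshears\<close>

text \<open>
  Holomorphy of a map in several variables is tested along entire curves; this is all that is
  needed to transport proper holomorphic embeddings.
\<close>

definition holo_map :: "(complex ^ 'n \<Rightarrow> complex ^ 'n) \<Rightarrow> bool" where
  "holo_map S \<longleftrightarrow> continuous_on UNIV S \<and>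
    (\<forall>\<phi>. (\<forall>i. (\<lambda>z. \<phi> z $ i) holomorphic_on UNIV) \<longrightarrow> (\<forall>i. (\<lambda>z. S (\<phi> z) $ i) holomorphic_on UNIV)) \<and>
    (\<forall>\<phi> z. (\<forall>i. ((\<lambda>z. \<phi> z $ i) has_field_derivative 0) (at z)) \<longrightarrow>
       (\<forall>i. ((\<lambda>z. S (\<phi> z) $ i) has_field_derivative 0) (at z)))"

lemma holo_map_DERIV_0:
  assumes "holo_map S" "\<And>i. ((\<lambda>z. \<phi> z $ i) has_field_derivative 0) (at z)"
  shows "((\<lambda>z. S (\<phi> z) $ i) has_field_derivative 0) (at z)"
  using assms unfolding holo_map_def by fast

lemma proper_holomorphic_embedding_compose:
  fixes \<phi> :: "complex \<Rightarrow> complex ^ 'n"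
  assumes "proper_holomorphic_embedding \<phi>" "holo_map S" "holo_map T"
    and ST: "\<And>x. T (S x) = x" "\<And>x. S (T x) = x"
  shows "proper_holomorphic_embedding (\<lambda>z. S (\<phi> z))"
  unfolding proper_holomorphic_embedding_def
proof (intro conjI allI impI)
  have inj: "inj \<phi>" and hol: "\<And>i. (\<lambda>z. \<phi> z $ i) holomorphic_on UNIV"
    and imm: "\<And>z. (\<chi> i. deriv (\<lambda>w. \<phi> w $ i) z) \<noteq> 0"
    and pre: "\<And>K. compact K \<Longrightarrow> compact (\<phi> -` K)"
    using assms(1) unfolding proper_holomorphic_embedding_def by auto
  show "inj (\<lambda>z. S (\<phi> z))" using inj ST by (metis (mono_tags, lifting) inj_on_def)
  show hS: "(\<lambda>z. S (\<phi> z) $ i) holomorphic_on UNIV" for i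
    using assms(2) hol unfolding holo_map_def by blast
  fix z
  show "(\<chi> i. deriv (\<lambda>w. S (\<phi> w) $ i) z) \<noteq> 0"
  proof
    assume "(\<chi> i. deriv (\<lambda>w. S (\<phi> w) $ i) z) = 0"
    then have 0: "deriv (\<lambda>w. S (\<phi> w) $ i) z = 0" for i by (simp add: vec_eq_iff)
    have "((\<lambda>w. S (\<phi> w) $ i) has_field_derivative 0) (at z)" for i
      using holomorphic_derivI[OF hS[of i] open_UNIV, of z] 0[of i] by simp
    \<comment> \<open>Immersions are preserved because the inverse \<open>T\<close> carries a zero
      of the derivative of \<open>S \<circ> \<phi>\<close> back to one of \<phi>.\<close>
    then have "((\<lambda>w. T (S (\<phi> w)) $ i) has_field_derivative 0) (at z)" for i
      by (rule holo_map_DERIV_0[OF assms(3)])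
    then have "deriv (\<lambda>w. \<phi> w $ i) z = 0" for i
      by (simp add: ST DERIV_imp_deriv)
    then show False using imm[of z] by (simp add: vec_eq_iff)
  qed
next
  fix K :: "(complex ^ 'n) set" assume "compact K"
  then have "compact (T ` K)"
    using assms(3) unfolding holo_map_def by (meson compact_continuous_image continuous_on_subset subset_UNIV)
  moreover have "(\<lambda>z. S (\<phi> z)) -` K = \<phi> -` (T ` K)"
    using ST by (auto simp: image_iff) metis+
  ultimately show "compact ((\<lambda>z. S (\<phi> z)) -` K)"
    using assms(1) unfolding proper_holomorphic_embedding_def by simp
qed

text \<open>The map \<open>cdot m x - r\<close> is a left inverse of \<phi>. This gives injectivity,
  a nonzero derivative, and properness: the preimage of \<open>K\<close> is a closed subset of the
  compact image of \<open>K\<close> under it.\<close>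

lemma proper_holomorphic_embedding_graph:
  fixes \<phi> :: "complex \<Rightarrow> complex ^ 'n"
  assumes hol: "\<And>i. (\<lambda>z. \<phi> z $ i) holomorphic_on UNIV"
    and m: "\<And>z. cdot m (\<phi> z) = z + r"
  shows "proper_holomorphic_embedding \<phi>"
  unfolding proper_holomorphic_embedding_def
proof (intro conjI allI impI)
  show "inj \<phi>" using m by (metis add_right_cancel injI)
  show "(\<lambda>z. \<phi> z $ i) holomorphic_on UNIV" for i by fact
  show "(\<chi> i. deriv (\<lambda>w. \<phi> w $ i) z) \<noteq> 0" for z
  proof
    assume "(\<chi> i. deriv (\<lambda>w. \<phi> w $ i) z) = 0"
    then have 0: "deriv (\<lambda>w. \<phi> w $ i) z = 0" for i by (simp add: vec_eq_iff)
    have "((\<lambda>w. \<phi> w $ i) has_field_derivative 0) (at z)" for i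
      using holomorphic_derivI[OF hol[of i] open_UNIV, of z] 0[of i] by simp
    then have "((\<lambda>w. cdot m (\<phi> w)) has_field_derivative 0) (at z)" by (rule DERIV_cdot_0)
    moreover have "((\<lambda>w. cdot m (\<phi> w)) has_field_derivative 1) (at z)"
      unfolding m by (auto intro!: derivative_eq_intros)
    ultimately show False using DERIV_unique zero_neq_one by blast
  qed
  fix K :: "(complex ^ 'n) set" assume K: "compact K"
  have "continuous_on UNIV (\<lambda>z. \<chi> i. \<phi> z $ i)"
    using hol by (intro continuous_on_vec_lambda holomorphic_on_imp_continuous_on)
  then have cont: "continuous_on UNIV \<phi>" by simp
  have "closed (\<phi> -` K)"
    using closed_vimage[OF compact_imp_closed[OF K] cont] .
  moreover have "compact ((\<lambda>x. cdot m x - r) ` K)"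
    by (intro compact_continuous_image continuous_intros K)
  moreover have "\<phi> -` K \<subseteq> (\<lambda>x. cdot m x - r) ` K"
  proof
    fix z assume "z \<in> \<phi> -` K"
    then show "z \<in> (\<lambda>x. cdot m x - r) ` K" by (intro image_eqI[where x="\<phi> z"]) (auto simp: m)
  qed
  ultimately show "compact (\<phi> -` K)"
    by (meson bounded_subset compact_eq_bounded_closed)
qed

lemma holo_map_shear:
  assumes hol: "\<And>i. (\<lambda>z. G z $ i) holomorphic_on UNIV"
  shows "holo_map (\<lambda>x. x + G (cdot l x))"
proof -
  have "continuous_on UNIV (\<lambda>z. \<chi> i. G z $ i)"
    using hol by (intro continuous_on_vec_lambda holomorphic_on_imp_continuous_on)
  then have cont: "continuous_on UNIV G" by simp
  have D: "((\<lambda>z. G z $ i) has_field_derivative deriv (\<lambda>z. G z $ i) z) (at z)" for i z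
    using holomorphic_derivI[OF hol[of i] open_UNIV, of z] by simp
  show ?thesis
    unfolding holo_map_def
  proof (intro conjI allI impI)
    show "continuous_on UNIV (\<lambda>x. x + G (cdot l x))"
      by (intro continuous_intros continuous_on_compose2[OF cont]) auto
    fix \<phi> :: "complex \<Rightarrow> complex ^ 'a" and i
    assume "\<forall>i. (\<lambda>z. \<phi> z $ i) holomorphic_on UNIV"
    then show "(\<lambda>z. (\<phi> z + G (cdot l (\<phi> z))) $ i) holomorphic_on UNIV"
      using holomorphic_on_compose_gen[OF holomorphic_on_cdot[of \<phi> UNIV l] hol[of i]]
      by (auto simp: o_def intro!: holomorphic_intros)
  next
    fix \<phi> :: "complex \<Rightarrow> complex ^ 'a" and i z
    assume \<phi>: "\<forall>i. ((\<lambda>z. \<phi> z $ i) has_field_derivative 0) (at z)"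
    have "((\<lambda>z. G (cdot l (\<phi> z)) $ i) has_field_derivative deriv (\<lambda>z. G z $ i) (cdot l (\<phi> z)) * 0) (at z)"
      using \<phi> by (intro DERIV_chain2[OF D] DERIV_cdot_0) auto
    with \<phi> show "((\<lambda>z. (\<phi> z + G (cdot l (\<phi> z))) $ i) has_field_derivative 0) (at z)"
      by (auto intro!: derivative_eq_intros)
  qed
qed

text \<open>The displacements lie in the kernel of \<open>l\<close>, hence so does \<open>G\<close>;
  the shear therefore preserves \<open>cdot l\<close> and is inverted by changing the sign of
  \<open>G\<close>. Subtracting \<open>G\<close> moves \<phi>' from the points
  \<open>a w + d w\<close> to \<open>a w\<close>. As \<phi> and \<phi>' have the same value under
  \<open>l\<close>, they differ by at most \<open>e\<close> wherever that value lies in the left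
  half plane.\<close>

lemma shear_pullback:
  assumes phe: "proper_holomorphic_embedding \<phi>'" and "\<And>w. w \<in> A \<Longrightarrow> \<phi>' w = a w + d w"
    and "finite A" "e > 0"
    and ker: "\<And>w. w \<in> A \<Longrightarrow> cdot l (d w) = 0"
    and "\<And>w w'. w \<in> A \<Longrightarrow> w' \<in> A \<Longrightarrow> cdot l (a w) = cdot l (a w') \<Longrightarrow> d w = d w'"
    and "\<And>w. w \<in> A \<Longrightarrow> Re (cdot l (a w)) \<le> c \<Longrightarrow> d w = 0"
  obtains \<phi> where "proper_holomorphic_embedding \<phi>" "\<And>w. w \<in> A \<Longrightarrow> \<phi> w = a w"
    "\<And>z. Re (cdot l (\<phi> z)) \<le> c \<Longrightarrow> norm (\<phi>' z - \<phi> z) \<le> e"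
    "\<And>l' z. (\<And>w. w \<in> A \<Longrightarrow> cdot l' (d w) = 0) \<Longrightarrow> cdot l' (\<phi> z) = cdot l' (\<phi>' z)"
proof -
  obtain G where hol: "\<And>i. (\<lambda>z. G z $ i) holomorphic_on UNIV"
    and Gd: "\<And>w. w \<in> A \<Longrightarrow> G (cdot l (a w)) = d w"
    and small: "\<And>z. Re z \<le> c \<Longrightarrow> norm (G z) \<le> e"
    and sub: "\<And>l z. (\<And>w. w \<in> A \<Longrightarrow> cdot l (d w) = 0) \<Longrightarrow> cdot l (G z) = 0"
    using entire_interpolation[of A e "\<lambda>w. cdot l (a w)" d c] assms(3,4,6,7) by metis
  have G0: "cdot l (G z) = 0" for z using sub ker by blast
  define \<phi> where "\<phi> z = \<phi>' z - G (cdot l (\<phi>' z))" for z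
  have "proper_holomorphic_embedding (\<lambda>z. (\<lambda>x. x + (\<lambda>w. - G w) (cdot l x)) (\<phi>' z))"
    by (rule proper_holomorphic_embedding_compose[OF phe, where T="\<lambda>x. x + G (cdot l x)"])
      (use hol G0 in \<open>auto intro!: holo_map_shear[where G="\<lambda>w. - G w", simplified] holo_map_shear holomorphic_intros\<close>)
  then have "proper_holomorphic_embedding \<phi>" by (simp add: \<phi>_def[abs_def])
  moreover have "\<phi> w = a w" if "w \<in> A" for w
    using that assms(2) ker Gd by (simp add: \<phi>_def)
  moreover have "norm (\<phi>' z - \<phi> z) \<le> e" if "Re (cdot l (\<phi> z)) \<le> c" for z
    using that small G0 by (simp add: \<phi>_def)
  moreover have "cdot l' (\<phi> z) = cdot l' (\<phi>' z)" if "\<And>w. w \<in> A \<Longrightarrow> cdot l' (d w) = 0" for l' z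
    using sub[OF that] by (simp add: \<phi>_def)
  ultimately show thesis using that by blast
qed

text \<open>When \<open>cdot l e = 1\<close> and \<open>cdot m e = 0\<close>, this map preserves
  \<open>cdot m x\<close> and multiplies \<open>cdot l x - r\<close> by a factor without zeros; it
  then fixes the hyperplane \<open>cdot l x = r\<close> pointwise and preserves its
  complement.\<close>

lemma holo_map_overshear:
  assumes g: "g holomorphic_on UNIV"
  shows "holo_map (\<lambda>x. x + ((cdot l x - r) * (exp (g (cdot m x)) - 1)) *s e)"
proof -
  have D: "(g has_field_derivative deriv g z) (at z)" for z
    using holomorphic_derivI[OF g open_UNIV, of z] by simp
  show ?thesis
    unfolding holo_map_def
  proof (intro conjI allI impI)
    show "continuous_on UNIV (\<lambda>x. x + ((cdot l x - r) * (exp (g (cdot m x)) - 1)) *s e)"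
      unfolding vector_scalar_mult_def
      by (intro continuous_intros continuous_on_compose2[OF holomorphic_on_imp_continuous_on[OF g]]) auto
    fix \<phi> :: "complex \<Rightarrow> complex ^ 'a" and i
    assume \<phi>: "\<forall>i. (\<lambda>z. \<phi> z $ i) holomorphic_on UNIV"
    then have "(\<lambda>z. g (cdot m (\<phi> z))) holomorphic_on UNIV"
      using holomorphic_on_compose_gen[OF holomorphic_on_cdot[of \<phi> UNIV m] g]
      by (auto simp: o_def)
    moreover have "(\<lambda>z. cdot l (\<phi> z)) holomorphic_on UNIV"
      using \<phi> by (intro holomorphic_on_cdot) auto
    ultimately show "(\<lambda>z. (\<phi> z + ((cdot l (\<phi> z) - r) * (exp (g (cdot m (\<phi> z))) - 1)) *s e) $ i) holomorphic_on UNIV"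
      using \<phi> by (auto intro!: holomorphic_intros)
  next
    fix \<phi> :: "complex \<Rightarrow> complex ^ 'a" and i z
    assume \<phi>: "\<forall>i. ((\<lambda>z. \<phi> z $ i) has_field_derivative 0) (at z)"
    have "((\<lambda>z. g (cdot m (\<phi> z))) has_field_derivative deriv g (cdot m (\<phi> z)) * 0) (at z)"
      using \<phi> by (intro DERIV_chain2[OF D] DERIV_cdot_0) auto
    moreover have "((\<lambda>z. cdot l (\<phi> z)) has_field_derivative 0) (at z)"
      using \<phi> by (intro DERIV_cdot_0) auto
    ultimately show "((\<lambda>z. (\<phi> z + ((cdot l (\<phi> z) - r) * (exp (g (cdot m (\<phi> z))) - 1)) *s e) $ i) has_field_derivative 0) (at z)"
      using \<phi> by (auto intro!: derivative_eq_intros)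
  qed
qed

section \<open>Interpolation by curves inside a hyperplane or inside its complement\<close>

lemma separating_functional:
  assumes A: "finite A" "inj_on a A" and "k \<noteq> 0"
  shows "\<exists>m. cdot m k \<noteq> 0 \<and> inj_on (\<lambda>w. cdot m (a w)) A"
proof -
  \<comment> \<open>A functional that is nonzero on all differences is injective on the points;
    adding \<open>k\<close> to the list makes it nonzero on \<open>k\<close> as well.\<close>
  define D where "D = {a w - a w' |w w'. w \<in> A \<and> w' \<in> A \<and> w \<noteq> w'}"
  have "D \<subseteq> (\<lambda>(w, w'). a w - a w') ` (A \<times> A)" unfolding D_def by auto
  then have "finite (insert k D)" using A(1) finite_subset by fastforce
  moreover have "d \<noteq> 0" if d: "d \<in> insert k D" for d
  proof (cases "d = k")
    case False
    then obtain w w' where "w \<in> A" "w' \<in> A" "w \<noteq> w'" "d = a w - a w'"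
      using d unfolding D_def by blast
    then show ?thesis using inj_onD[OF A(2), of w w'] by auto
  qed (use \<open>k \<noteq> 0\<close> in simp)
  ultimately obtain m where m: "\<forall>d\<in>insert k D. cdot m d \<noteq> 0" using generic_functional by blast
  have "w = w'" if "w \<in> A" "w' \<in> A" "cdot m (a w) = cdot m (a w')" for w w'
  proof (rule ccontr)
    assume "w \<noteq> w'"
    then have "a w - a w' \<in> D" using that unfolding D_def by blast
    then have "cdot m (a w - a w') \<noteq> 0" using m by blast
    then show False using that(3) by simp
  qed
  then show ?thesis using m by (auto intro!: inj_onI)
qed

lemma finite_strict_lower_bound:
  fixes f :: "'a \<Rightarrow> real"
  assumes "finite A"
  shows "\<exists>c. \<forall>w\<in>A. c < f w"
proof (intro exI ballI)
  fix w assume "w \<in> A"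
  then have "Min (f ` A) \<le> f w" using assms by simp
  then show "Min (f ` A) - 1 < f w" by linarith
qed

text \<open>This is the vector version in dimension one, with \<open>c\<close> to the left of all
  nodes, so that no value is forced to be 0.\<close>

lemma entire_scalar_interpolation:
  assumes "finite A" "inj_on p A"
  shows "\<exists>g. g holomorphic_on UNIV \<and> (\<forall>w\<in>A. g (p w) = s w)"
proof -
  obtain c where c: "\<And>w. w \<in> A \<Longrightarrow> c < Re (p w)"
    using finite_strict_lower_bound[OF assms(1), of "\<lambda>w. Re (p w)"] by blast
  have "\<exists>G. (\<forall>i. (\<lambda>z. G z $ i) holomorphic_on UNIV) \<and> (\<forall>w\<in>A. G (p w) = (\<chi> i::1. s w)) \<and>
      (\<forall>z. Re z \<le> c \<longrightarrow> norm (G z) \<le> 1) \<and>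
      (\<forall>l. (\<forall>w\<in>A. cdot l (\<chi> i::1. s w) = 0) \<longrightarrow> (\<forall>z. cdot l (G z) = 0))"
  proof (rule entire_interpolation[OF assms(1) zero_less_one])
    show "(\<chi> i::1. s w) = (\<chi> i. s w')" if "w \<in> A" "w' \<in> A" "p w = p w'" for w w'
      using inj_onD[OF assms(2) that(3,1,2)] by simp
    show "(\<chi> i::1. s w) = 0" if "w \<in> A" "Re (p w) \<le> c" for w
      using c[OF that(1)] that(2) by simp
  qed
  then obtain G where "\<And>i. (\<lambda>z. G z $ i) holomorphic_on UNIV"
      "\<And>w. w \<in> A \<Longrightarrow> G (p w) = (\<chi> i::1. s w)" by blast
  then show ?thesis by (intro exI[of _ "\<lambda>z. G z $ 1"]) auto
qed

text \<open>A half plane to the left of all points leaves the displacements unrestricted, and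
  injectivity of \<open>l\<close> on the points makes them functions of
  \<open>cdot l (a w)\<close>.\<close>

lemma entire_shear_pullback:
  assumes "proper_holomorphic_embedding \<phi>'" "\<And>w. w \<in> A \<Longrightarrow> \<phi>' w = a w + d w"
    and "finite A" "\<And>w. w \<in> A \<Longrightarrow> cdot l (d w) = 0"
    and "inj_on (\<lambda>w. cdot l (a w)) A"
  obtains \<phi> where "proper_holomorphic_embedding \<phi>" "\<And>w. w \<in> A \<Longrightarrow> \<phi> w = a w"
    "\<And>l' z. (\<And>w. w \<in> A \<Longrightarrow> cdot l' (d w) = 0) \<Longrightarrow> cdot l' (\<phi> z) = cdot l' (\<phi>' z)"
proof -
  obtain c where c: "\<And>w. w \<in> A \<Longrightarrow> c < Re (cdot l (a w))"
    using finite_strict_lower_bound[OF assms(3), of "\<lambda>w. Re (cdot l (a w))"] by blast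
  show thesis
    by (rule shear_pullback[where l=l and c=c, OF assms(1,2,3) zero_less_one assms(4)])
      (use assms(5) c that in \<open>auto simp: inj_on_def not_le[symmetric]\<close>)
qed

text \<open>Start from the line \<open>b + z *s e2\<close> in the hyperplane. A shear in the
  variable \<open>l1\<close> along \<open>e1\<close> gives its points the right value of
  \<open>m\<close>, a shear in the variable \<open>m\<close> then carries them to
  \<open>a w\<close>. All displacements lie in the kernel of \<open>l0\<close>, so the curve stays
  in the hyperplane.\<close>

lemma hyperplane_embedding:
  assumes A: "finite A" "inj_on a A" and a: "\<And>w. w \<in> A \<Longrightarrow> cdot l0 (a w) = r"
    and b0: "cdot l0 b0 = r" and k: "k \<noteq> 0" "cdot l0 k = 0" "cdot l1 k = 0"
    and f: "cdot l0 f = 0" "cdot l1 f = 1"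
  shows "\<exists>\<phi>. proper_holomorphic_embedding \<phi> \<and> (\<forall>w\<in>A. \<phi> w = a w) \<and> (\<forall>z. cdot l0 (\<phi> z) = r)"
proof -
  obtain m where mk: "cdot m k \<noteq> 0" and inj_m: "inj_on (\<lambda>w. cdot m (a w)) A"
    using separating_functional[OF A k(1)] by blast
  define e1 where "e1 = (1 / cdot m k) *s k"
  define e2 where "e2 = f - cdot m f *s e1"
  define b where "b = b0 - cdot l1 b0 *s e2 - cdot m b0 *s e1"
  have e1 [simp]: "cdot m e1 = 1" "cdot l0 e1 = 0" "cdot l1 e1 = 0"
    using mk k by (simp_all add: e1_def)
  have e2 [simp]: "cdot m e2 = 0" "cdot l0 e2 = 0" "cdot l1 e2 = 1"
    using f by (simp_all add: e2_def)
  have b [simp]: "cdot m b = 0" "cdot l0 b = r" "cdot l1 b = 0"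
    by (simp_all add: b_def b0)
  define a1 where "a1 w = b + cdot m (a w) *s e1 + w *s e2" for w
  have "proper_holomorphic_embedding (\<lambda>z. b + z *s e2)"
    by (rule proper_holomorphic_embedding_graph[where m=l1 and r=0]) (auto intro!: holomorphic_intros)
  then obtain \<phi>1 where \<phi>1: "proper_holomorphic_embedding \<phi>1" "\<And>w. w \<in> A \<Longrightarrow> \<phi>1 w = a1 w"
    "\<And>l' z. (\<And>w. w \<in> A \<Longrightarrow> cdot l' (- cdot m (a w) *s e1) = 0) \<Longrightarrow> cdot l' (\<phi>1 z) = cdot l' (b + z *s e2)"
    by (rule entire_shear_pullback[of _ A a1 "\<lambda>w. - cdot m (a w) *s e1" l1])
      (use A in \<open>auto simp: a1_def inj_on_def\<close>)
  obtain \<phi> where \<phi>: "proper_holomorphic_embedding \<phi>" "\<And>w. w \<in> A \<Longrightarrow> \<phi> w = a w"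
    "\<And>l' z. (\<And>w. w \<in> A \<Longrightarrow> cdot l' (a1 w - a w) = 0) \<Longrightarrow> cdot l' (\<phi> z) = cdot l' (\<phi>1 z)"
    by (rule entire_shear_pullback[OF \<phi>1(1), of A a "\<lambda>w. a1 w - a w" m])
      (use A \<phi>1 inj_m in \<open>auto simp: a1_def\<close>)
  have "cdot l0 (\<phi> z) = r" for z
    using \<phi>(3)[of l0 z] \<phi>1(3)[of l0 z] a by (simp add: a1_def)
  with \<phi> show ?thesis by blast
qed

lemma hyperplane_complement_embedding:
  fixes a :: "complex \<Rightarrow> complex ^ 'n"
  assumes A: "finite A" "inj_on a A" and a: "\<And>w. w \<in> A \<Longrightarrow> cdot l (a w) \<noteq> r"
    and e: "cdot l e = 1" and k: "k \<noteq> 0" "cdot l k = 0"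
  shows "\<exists>\<phi>. proper_holomorphic_embedding \<phi> \<and> (\<forall>w\<in>A. \<phi> w = a w) \<and> (\<forall>z. cdot l (\<phi> z) \<noteq> r)"
proof -
  obtain m where mk: "cdot m k \<noteq> 0" and inj_m: "inj_on (\<lambda>w. cdot m (a w)) A"
    using separating_functional[OF A k(1)] by blast
  define k1 where "k1 = (1 / cdot m k) *s k"
  define e0 where "e0 = e - cdot m e *s k1"
  have k1 [simp]: "cdot m k1 = 1" "cdot l k1 = 0" using mk k by (simp_all add: k1_def)
  have e0 [simp]: "cdot m e0 = 0" "cdot l e0 = 1" using e by (simp_all add: e0_def)
  obtain t where t: "t > 0" "inj_on (\<lambda>w. exp (of_real t * w)) A"
    using exp_scaled_inj_on[OF A(1)] by blast
  \<comment> \<open>The values of \<open>l\<close> on \<open>\<phi>2\<close> differ from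
    \<open>r\<close> everywhere and are distinct at the nodes. The intermediate point
    \<open>a1 w\<close> agrees with \<open>\<phi>2 w\<close> under \<open>l\<close> and with
    \<open>a w\<close> under \<open>m\<close>: a shear in \<open>l\<close> leads from
    \<open>\<phi>2 w\<close> to \<open>a1 w\<close>, an overshear in \<open>m\<close> from there to
    \<open>a w\<close>.\<close>
  define \<phi>2 where "\<phi>2 z = z *s k1 + (r + exp (of_real t * z)) *s e0" for z
  define a1 where "a1 w = a w + (exp (of_real t * w) - (cdot l (a w) - r)) *s e0" for w
  have "proper_holomorphic_embedding \<phi>2"
    by (rule proper_holomorphic_embedding_graph[where m=m and r=0])
      (auto simp: \<phi>2_def intro!: holomorphic_intros)
  then obtain \<phi>1 where \<phi>1: "proper_holomorphic_embedding \<phi>1" "\<And>w. w \<in> A \<Longrightarrow> \<phi>1 w = a1 w"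
    "\<And>l' z. (\<And>w. w \<in> A \<Longrightarrow> cdot l' (\<phi>2 w - a1 w) = 0) \<Longrightarrow> cdot l' (\<phi>1 z) = cdot l' (\<phi>2 z)"
    by (rule entire_shear_pullback[of _ A a1 "\<lambda>w. \<phi>2 w - a1 w" l])
      (use A t in \<open>auto simp: a1_def \<phi>2_def inj_on_def\<close>)
  have l1: "cdot l (\<phi>1 z) = r + exp (of_real t * z)" for z
    using \<phi>1(3)[of l z] by (simp add: a1_def \<phi>2_def)
  \<comment> \<open>At the nodes \<open>exp (g (cdot m (a w)))\<close> is the ratio of
    \<open>cdot l (a1 w) - r\<close> to \<open>cdot l (a w) - r\<close>, so the overshear
    \<open>S 1\<close> takes \<open>a w\<close> to \<open>a1 w\<close>; its inverse
    \<open>S (- 1)\<close> is the map to apply.\<close>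
  obtain g where g: "g holomorphic_on UNIV"
    "\<And>w. w \<in> A \<Longrightarrow> g (cdot m (a w)) = of_real t * w - ln (cdot l (a w) - r)"
    using entire_scalar_interpolation[OF A(1) inj_m, of "\<lambda>w. of_real t * w - ln (cdot l (a w) - r)"]
    by blast
  define S where "S s x = x + ((cdot l x - r) * (exp (s * g (cdot m x)) - 1)) *s e0" for s x
  have S: "cdot m (S s x) = cdot m x" "cdot l (S s x) - r = (cdot l x - r) * exp (s * g (cdot m x))" for s x
    by (simp_all add: S_def algebra_simps)
  have inv: "S (- s) (S s x) = x" for s x
  proof -
    have "S (- s) (S s x) = S s x + ((cdot l x - r) * exp (s * g (cdot m x)) * (exp (- s * g (cdot m x)) - 1)) *s e0"
      by (subst S_def) (simp add: S)
    also have "\<dots> = x + ((cdot l x - r) * (exp (s * g (cdot m x)) * exp (- s * g (cdot m x)) - 1)) *s e0"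
      by (simp add: S_def vec_eq_iff algebra_simps)
    also have "\<dots> = x" by (simp flip: exp_add)
    finally show ?thesis .
  qed
  have hS: "holo_map (S s)" for s
    unfolding S_def using holo_map_overshear[of "\<lambda>z. s * g z"] g(1)
    by (simp add: holomorphic_on_mult)
  define \<phi> where "\<phi> z = S (- 1) (\<phi>1 z)" for z
  have "proper_holomorphic_embedding \<phi>"
    unfolding \<phi>_def using inv[of 1] inv[of "- 1"]
    by (intro proper_holomorphic_embedding_compose[OF \<phi>1(1) hS hS[of 1]]) auto
  moreover have "\<phi> w = a w" if w: "w \<in> A" for w
  proof -
    have "exp (g (cdot m (a w))) = exp (of_real t * w) / (cdot l (a w) - r)"
      using a[OF w] by (simp add: g(2)[OF w] exp_diff)
    then have "a1 w = S 1 (a w)"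
      using a[OF w] by (simp add: S_def a1_def field_simps)
    then show ?thesis
      using \<phi>1(2)[OF w] inv[of 1 "a w"] by (simp add: \<phi>_def)
  qed
  moreover have "cdot l (\<phi> z) \<noteq> r" for z
    using S(2)[of "-1" "\<phi>1 z"] by (auto simp: \<phi>_def l1)
  ultimately show ?thesis by blast
qed

section \<open>Avoiding a finite intersection of half spaces\<close>

text \<open>The curve avoids the polyhedron of all \<open>x\<close> with
  \<open>Re (cdot l x) \<le> c l\<close> for every \<open>l\<close> in \<open>L\<close>. The bounds
  form a function so that all of them can be raised at once.\<close>

definition solvable ::
  "complex set \<Rightarrow> (complex \<Rightarrow> complex ^ 'n) \<Rightarrow> (complex ^ 'n) set \<Rightarrow> (complex ^ 'n \<Rightarrow> real) \<Rightarrow> bool" where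
  "solvable A a L c \<longleftrightarrow> (\<exists>\<phi>. proper_holomorphic_embedding \<phi> \<and> (\<forall>w\<in>A. \<phi> w = a w) \<and>
     (\<forall>z. \<exists>l\<in>L. c l < Re (cdot l (\<phi> z))))"

text \<open>A shear in \<open>l \<in> L\<close> costs only \<delta> in each bound. Where \<phi>
  enters the polyhedron for \<open>c\<close>, its value under \<open>l\<close> is in the left half
  plane, so \<phi>' is within \<epsilon> of it and every functional in \<open>L\<close> changes by
  at most \<delta>; then \<phi>' would enter the enlarged polyhedron.\<close>

lemma solvable_shear:
  assumes "finite A" "finite L" "l \<in> L" "\<delta> > 0"
    and ker: "\<And>w. w \<in> A \<Longrightarrow> cdot l (d w) = 0"
    and "\<And>w w'. w \<in> A \<Longrightarrow> w' \<in> A \<Longrightarrow> cdot l (a w) = cdot l (a w') \<Longrightarrow> d w = d w'"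
    and "\<And>w. w \<in> A \<Longrightarrow> Re (cdot l (a w)) \<le> c l \<Longrightarrow> d w = 0"
    and sol: "solvable A (\<lambda>w. a w + d w) L (\<lambda>l. c l + \<delta>)"
  shows "solvable A a L c"
proof -
  define N :: "complex ^ 'a \<Rightarrow> real" where "N m = (\<Sum>i\<in>UNIV. norm (m $ i))" for m
  define \<epsilon> where "\<epsilon> = \<delta> / ((\<Sum>m\<in>L. N m) + 1)"
  have N: "N m \<ge> 0" for m unfolding N_def by (intro sum_nonneg) auto
  then have pos: "(\<Sum>m\<in>L. N m) + 1 > 0" by (smt (verit) sum_nonneg)
  then have \<epsilon>: "\<epsilon> > 0" using assms(4) by (simp add: \<epsilon>_def)
  have le: "norm (cdot m x) \<le> \<delta>" if "norm x \<le> \<epsilon>" "m \<in> L" for m x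
  proof -
    have "norm (cdot m x) \<le> N m * norm x" unfolding N_def by (rule norm_cdot_le)
    also have "\<dots> \<le> ((\<Sum>m\<in>L. N m) + 1) * \<epsilon>"
    proof (rule mult_mono)
      show "N m \<le> (\<Sum>m\<in>L. N m) + 1"
        using member_le_sum[of m L N] that(2) N assms(2) by simp
    qed (use that pos in auto)
    also have "\<dots> = \<delta>" using pos by (simp add: \<epsilon>_def)
    finally show ?thesis .
  qed
  obtain \<phi>' where \<phi>': "proper_holomorphic_embedding \<phi>'" "\<And>w. w \<in> A \<Longrightarrow> \<phi>' w = a w + d w"
    "\<And>z. \<exists>l\<in>L. c l + \<delta> < Re (cdot l (\<phi>' z))"
    using sol unfolding solvable_def by blast
  obtain \<phi> where \<phi>: "proper_holomorphic_embedding \<phi>" "\<And>w. w \<in> A \<Longrightarrow> \<phi> w = a w"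
    "\<And>z. Re (cdot l (\<phi> z)) \<le> c l \<Longrightarrow> norm (\<phi>' z - \<phi> z) \<le> \<epsilon>"
    by (rule shear_pullback[where a=a and d=d and l=l and c="c l", OF \<phi>'(1,2) assms(1) \<epsilon> assms(5,6,7)])
      (use that in blast)+
  have "\<exists>m\<in>L. c m < Re (cdot m (\<phi> z))" for z
  proof (rule ccontr)
    assume *: "\<not> (\<exists>m\<in>L. c m < Re (cdot m (\<phi> z)))"
    obtain m where m: "m \<in> L" "c m + \<delta> < Re (cdot m (\<phi>' z))" using \<phi>'(3) by blast
    have "norm (\<phi>' z - \<phi> z) \<le> \<epsilon>" using \<phi>(3) * assms(3) by fastforce
    then have "Re (cdot m (\<phi>' z - \<phi> z)) \<le> \<delta>"
      using le[OF _ m(1)] complex_Re_le_cmod order_trans by meson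
    then show False using m * by fastforce
  qed
  then show ?thesis using \<phi> unfolding solvable_def by blast
qed

lemma inj_on_shear:
  assumes "inj_on a A" "\<And>w. w \<in> A \<Longrightarrow> cdot l (d w) = 0"
    and "\<And>w w'. w \<in> A \<Longrightarrow> w' \<in> A \<Longrightarrow> cdot l (a w) = cdot l (a w') \<Longrightarrow> d w = d w'"
  shows "inj_on (\<lambda>w. a w + d w) A"
proof (rule inj_onI)
  fix w w' assume w: "w \<in> A" "w' \<in> A" "a w + d w = a w' + d w'"
  then have "cdot l (a w + d w) = cdot l (a w' + d w')" by simp
  then have "cdot l (a w) = cdot l (a w')" using assms(2)[OF w(1)] assms(2)[OF w(2)] by simp
  then have "a w = a w'" using assms(3) w by (metis add_right_cancel)
  then show "w = w'" using assms(1) w by (auto dest: inj_onD)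
qed

text \<open>It allows raising all bounds by one \<delta> without losing any of finitely many strict
  inequalities.\<close>

lemma uniform_slack:
  fixes f :: "'a \<Rightarrow> real"
  assumes "finite T"
  shows "\<exists>\<delta>>0. \<forall>t\<in>T. f t > 0 \<longrightarrow> f t > \<delta>"
  using assms
proof (induction T)
  case empty
  then show ?case by (auto intro: exI[of _ 1])
next
  case (insert t T)
  then obtain \<delta> where \<delta>: "\<delta> > 0" "\<forall>t\<in>T. f t > 0 \<longrightarrow> f t > \<delta>" by blast
  show ?case
  proof (cases "f t > 0")
    case True
    then show ?thesis using \<delta> by (intro exI[of _ "min \<delta> (f t / 2)"]) auto
  qed (use \<delta> in auto)
qed

text \<open>The dual vectors witness the independence of \<open>l1\<close> and \<open>l2\<close>:
  moving along \<open>v2\<close> is a shear direction for \<open>l1\<close>, and conversely.\<close>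

locale independent_functionals =
  fixes l1 l2 v1 v2 :: "complex ^ 'n" and A :: "complex set" and L :: "(complex ^ 'n) set"
  assumes finite_points: "finite A" and finite_functionals: "finite L"
    and mem: "l1 \<in> L" "l2 \<in> L"
    and dual [simp]: "cdot l1 v1 = 1" "cdot l1 v2 = 0" "cdot l2 v1 = 0" "cdot l2 v2 = 1"
begin

lemma solvable_graph:
  assumes inj: "inj_on a A" and x: "\<And>w. w \<in> A \<Longrightarrow> c l1 < Re (cdot l1 (a w))"
    and graph: "\<And>w w'. w \<in> A \<Longrightarrow> w' \<in> A \<Longrightarrow> cdot l1 (a w) = cdot l1 (a w') \<Longrightarrow> cdot l2 (a w) = cdot l2 (a w')"
  shows "solvable A a L c"
proof (cases "\<exists>k. k \<noteq> 0 \<and> cdot l1 k = 0 \<and> cdot l2 k = 0")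
  case True
  then obtain k where k: "k \<noteq> 0" "cdot l1 k = 0" "cdot l2 k = 0" by blast
  \<comment> \<open>On the hyperplane where \<open>l1 + l2\<close> takes the value
    \<open>2 * R\<close>, one of the two real parts exceeds its bound by more than 1. As
    \<open>l1\<close> determines \<open>l2\<close> on the points, a shear in \<open>l1\<close> can
    put them there.\<close>
  define R :: complex where "R = of_real (\<bar>c l1\<bar> + \<bar>c l2\<bar> + 2)"
  define d where "d w = (2 * R - cdot l1 (a w) - cdot l2 (a w)) *s v2" for w
  have d_eq: "d w = d w'" if "w \<in> A" "w' \<in> A" "cdot l1 (a w) = cdot l1 (a w')" for w w'
    unfolding d_def using graph[OF that] that(3) by simp
  have "inj_on (\<lambda>w. a w + d w) A"
    by (rule inj_on_shear[where l=l1, OF inj _ d_eq]) (simp add: d_def)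
  then have "\<exists>\<phi>. proper_holomorphic_embedding \<phi> \<and> (\<forall>w\<in>A. \<phi> w = a w + d w) \<and>
      (\<forall>z. cdot (l1 + l2) (\<phi> z) = 2 * R)"
  proof (rule hyperplane_embedding[where ?b0.0="R *s v1 + R *s v2" and k=k and f="v1 - v2" and ?l1.0=l1, OF finite_points])
    show "cdot (l1 + l2) (R *s v1 + R *s v2) = 2 * R" "cdot (l1 + l2) (v1 - v2) = 0" "cdot l1 (v1 - v2) = 1"
      by simp_all
    show "k \<noteq> 0" "cdot (l1 + l2) k = 0" "cdot l1 k = 0" using k by simp_all
  qed (simp add: d_def)
  then obtain \<phi> where \<phi>: "proper_holomorphic_embedding \<phi>" "\<And>w. w \<in> A \<Longrightarrow> \<phi> w = a w + d w"
      "\<And>z. cdot (l1 + l2) (\<phi> z) = 2 * R"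
    by blast
  have "\<exists>l\<in>L. c l + 1 < Re (cdot l (\<phi> z))" for z
  proof -
    have "Re (cdot l1 (\<phi> z)) + Re (cdot l2 (\<phi> z)) = 2 * (\<bar>c l1\<bar> + \<bar>c l2\<bar> + 2)"
      using arg_cong[OF \<phi>(3)[of z], of Re] by (simp add: R_def)
    then have "c l1 + 1 < Re (cdot l1 (\<phi> z)) \<or> c l2 + 1 < Re (cdot l2 (\<phi> z))"
      using abs_ge_self[of "c l1"] abs_ge_self[of "c l2"] by argo
    then show ?thesis using mem by blast
  qed
  then have sol: "solvable A (\<lambda>w. a w + d w) L (\<lambda>l. c l + 1)"
    using \<phi> unfolding solvable_def by blast
  show ?thesis
  proof (rule solvable_shear[OF finite_points finite_functionals mem(1) zero_less_one _ _ _ sol])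
    show "d w = d w'" if "w \<in> A" "w' \<in> A" "cdot l1 (a w) = cdot l1 (a w')" for w w'
      using that by (rule d_eq)
    show "d w = 0" if "w \<in> A" "Re (cdot l1 (a w)) \<le> c l1" for w
      using that x[of w] by simp
  qed (simp add: d_def)
next
  case False
  \<comment> \<open>The space now has dimension two and the hyperplane is a line, so the parameters
    must be matched as well. On the line of points \<open>(R + z, R - z)\<close>, \<open>d1\<close>
    is the shear in \<open>l1\<close> that corrects \<open>l2\<close> to \<open>R - w\<close>, and
    \<open>d2\<close> the shear in \<open>l2\<close> that corrects \<open>l1\<close> to
    \<open>R + w\<close>.\<close>
  have basis: "y = cdot l1 y *s v1 + cdot l2 y *s v2" for y
  proof -
    have "cdot l1 (y - (cdot l1 y *s v1 + cdot l2 y *s v2)) = 0"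
      "cdot l2 (y - (cdot l1 y *s v1 + cdot l2 y *s v2)) = 0" by simp_all
    then have "y - (cdot l1 y *s v1 + cdot l2 y *s v2) = 0" using False by blast
    then show ?thesis by simp
  qed
  have inj_x: "w = w'" if "w \<in> A" "w' \<in> A" "cdot l1 (a w) = cdot l1 (a w')" for w w'
    using basis[of "a w"] basis[of "a w'"] graph[OF that] that inj_onD[OF inj] by metis
  \<comment> \<open>This makes \<open>Re (R - w)\<close> exceed \<open>c l2 + 1\<close>, so all
    points may be moved by the second shear. Two shears cost 1 each, hence the line has to clear the
    bounds \<open>c + 1 + 1\<close>.\<close>
  obtain m where m: "\<And>w. w \<in> A \<Longrightarrow> m < Re (- w)"
    using finite_strict_lower_bound[OF finite_points, of "\<lambda>w. Re (- w)"] by blast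
  define R :: complex where "R = of_real (\<bar>c l1\<bar> + \<bar>c l2\<bar> + \<bar>m\<bar> + 3)"
  define d1 where "d1 w = (R - w - cdot l2 (a w)) *s v2" for w
  define d2 where "d2 w = (R + w - cdot l1 (a w)) *s v1" for w
  define \<phi> where "\<phi> z = (R + z) *s v1 + (R - z) *s v2" for z
  have "proper_holomorphic_embedding \<phi>"
    by (rule proper_holomorphic_embedding_graph[where m=l1 and r=R])
      (auto simp: \<phi>_def intro!: holomorphic_intros)
  moreover have "\<phi> w = a w + d1 w + d2 w" for w
    by (subst basis[of "a w"]) (simp add: \<phi>_def d1_def d2_def vec_eq_iff algebra_simps)
  moreover have "\<exists>l\<in>L. c l + 1 + 1 < Re (cdot l (\<phi> z))" for z
  proof -
    have "c l1 + 1 + 1 < Re (cdot l1 (\<phi> z)) \<or> c l2 + 1 + 1 < Re (cdot l2 (\<phi> z))"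
      unfolding \<phi>_def by (auto simp: R_def)
    then show ?thesis using mem by blast
  qed
  ultimately have "solvable A (\<lambda>w. a w + d1 w + d2 w) L (\<lambda>l. c l + 1 + 1)"
    unfolding solvable_def by metis
  then have "solvable A (\<lambda>w. a w + d1 w) L (\<lambda>l. c l + 1)"
  proof (rule solvable_shear[OF finite_points finite_functionals mem(2) zero_less_one, rotated -1])
    show "d2 w = 0" if "w \<in> A" "Re (cdot l2 (a w + d1 w)) \<le> c l2 + 1" for w
      using that m[OF that(1)] by (simp add: d1_def R_def)
  qed (auto simp: d1_def d2_def)
  then show ?thesis
  proof (rule solvable_shear[OF finite_points finite_functionals mem(1) zero_less_one, rotated -1])
    show "d1 w = 0" if "w \<in> A" "Re (cdot l1 (a w)) \<le> c l1" for w
      using that x by fastforce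
    show "d1 w = d1 w'" if "w \<in> A" "w' \<in> A" "cdot l1 (a w) = cdot l1 (a w')" for w w'
      using inj_x[OF that] by simp
  qed (auto simp: d1_def)
qed

lemma solvable_half_space:
  assumes inj: "inj_on a A" and y: "\<And>w. w \<in> A \<Longrightarrow> c l2 < Re (cdot l2 (a w))"
  shows "solvable A a L c"
proof -
  have "finite ((\<lambda>w. cdot l2 (a w)) ` A)" using finite_points by simp
  then obtain idx :: "complex \<Rightarrow> nat" where idx: "inj_on idx ((\<lambda>w. cdot l2 (a w)) ` A)"
    using finite_imp_inj_to_nat_seg[of "(\<lambda>w. cdot l2 (a w)) ` A"] by metis
  obtain B where B: "\<And>w. w \<in> A \<Longrightarrow> norm (cdot l1 (a w)) \<le> B"
    using finite_imp_bounded[of "(\<lambda>w. cdot l1 (a w)) ` A"] finite_points by (auto simp: bounded_iff)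
  \<comment> \<open>\<open>M\<close> exceeds the spread \<open>2 * \<bar>B\<bar>\<close> of the real
    parts of \<open>l1\<close>, and one step of length \<open>M\<close> lifts each of them above
    \<open>c l1 + 1\<close>.\<close>
  define M where "M = 2 * \<bar>B\<bar> + \<bar>c l1\<bar> + 2"
  \<comment> \<open>The translations along \<open>v1\<close> for different values of \<open>l2\<close> are so far apart that afterwards
    \<open>l1\<close> determines \<open>l2\<close>.\<close>
  define d where "d w = of_real (M * (real (idx (cdot l2 (a w))) + 1)) *s v1" for w
  have x: "c l1 + 1 < Re (cdot l1 (a w + d w))" if "w \<in> A" for w
  proof -
    have "M * 1 \<le> M * (real (idx (cdot l2 (a w))) + 1)"
      unfolding M_def by (intro mult_left_mono) auto
    moreover have "- \<bar>B\<bar> \<le> Re (cdot l1 (a w))"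
      using B[OF that] abs_Re_le_cmod[of "cdot l1 (a w)"] by linarith
    ultimately show ?thesis using abs_ge_zero[of B] by (simp add: d_def M_def)
  qed
  have "cdot l2 (a w) = cdot l2 (a w')"
    if w: "w \<in> A" "w' \<in> A" and eq: "cdot l1 (a w + d w) = cdot l1 (a w' + d w')" for w w'
  proof (rule ccontr)
    assume "cdot l2 (a w) \<noteq> cdot l2 (a w')"
    then have "idx (cdot l2 (a w)) \<noteq> idx (cdot l2 (a w'))"
      using idx w by (auto dest: inj_onD)
    then have "1 \<le> \<bar>real (idx (cdot l2 (a w))) - real (idx (cdot l2 (a w')))\<bar>" by linarith
    then have "M * 1 \<le> M * \<bar>real (idx (cdot l2 (a w))) - real (idx (cdot l2 (a w')))\<bar>"
      unfolding M_def by (intro mult_left_mono) auto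
    also have "\<dots> = \<bar>M * real (idx (cdot l2 (a w))) - M * real (idx (cdot l2 (a w')))\<bar>"
      by (simp add: M_def abs_mult flip: right_diff_distrib)
    also have "\<dots> = \<bar>Re (cdot l1 (a w)) - Re (cdot l1 (a w'))\<bar>"
      using arg_cong[OF eq, of Re] by (simp add: d_def algebra_simps)
    also have "\<dots> \<le> 2 * \<bar>B\<bar>"
      using B[OF w(1)] abs_Re_le_cmod[of "cdot l1 (a w)"]
        B[OF w(2)] abs_Re_le_cmod[of "cdot l1 (a w')"] by linarith
    finally show False by (simp add: M_def)
  qed
  moreover have "inj_on (\<lambda>w. a w + d w) A"
    by (rule inj_on_shear[OF inj, of l2]) (auto simp: d_def)
  ultimately have "solvable A (\<lambda>w. a w + d w) L (\<lambda>l. c l + 1)"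
    by (intro solvable_graph) (use x in \<open>auto simp: d_def\<close>)
  then show ?thesis
    by (rule solvable_shear[OF finite_points finite_functionals mem(2) zero_less_one, rotated -1])
      (use y in \<open>force simp: d_def\<close>)+
qed

text \<open>Points beyond the bound for \<open>l1\<close> may be pushed along \<open>v2\<close> by a
  shear in \<open>l1\<close> until they pass the raised bound for \<open>l2\<close>. The remaining
  points are beyond the bound for \<open>l2\<close> already, with slack \<delta>.\<close>

lemma solvable_outside_product:
  assumes inj: "inj_on a A"
    and a: "\<And>w. w \<in> A \<Longrightarrow> c l1 < Re (cdot l1 (a w)) \<or> c l2 < Re (cdot l2 (a w))"
  shows "solvable A a L c"
proof -
  obtain \<delta> where \<delta>: "\<delta> > 0" "\<And>w. w \<in> A \<Longrightarrow> Re (cdot l2 (a w)) - c l2 > 0 \<Longrightarrow> Re (cdot l2 (a w)) - c l2 > \<delta>"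
    using uniform_slack[OF finite_points, of "\<lambda>w. Re (cdot l2 (a w)) - c l2"] by blast
  obtain m where m: "\<And>w. w \<in> A \<Longrightarrow> m < Re (cdot l2 (a w))"
    using finite_strict_lower_bound[OF finite_points, of "\<lambda>w. Re (cdot l2 (a w))"] by blast
  define d where "d w = (if Re (cdot l1 (a w)) \<le> c l1 then 0 else of_real (c l2 + \<delta> - m) *s v2)" for w
  have "inj_on (\<lambda>w. a w + d w) A"
    by (rule inj_on_shear[OF inj, of l1]) (auto simp: d_def)
  then have "solvable A (\<lambda>w. a w + d w) L (\<lambda>l. c l + \<delta>)"
  proof (rule solvable_half_space)
    show "c l2 + \<delta> < Re (cdot l2 (a w + d w))" if "w \<in> A" for w
      using m[OF that] a[OF that] \<delta>(2)[OF that] by (auto simp: d_def)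
  qed
  then show ?thesis
    by (rule solvable_shear[OF finite_points finite_functionals mem(1) \<delta>(1), rotated -1])
      (auto simp: d_def)
qed

text \<open>The kernel of \<open>l\<close> meets the span of \<open>v1\<close> and \<open>v2\<close>
  nontrivially, so a shear in \<open>l\<close> can increase \<open>l1\<close> or
  \<open>l2\<close>.\<close>

lemma exists_escape_direction:
  "\<exists>v. cdot l v = 0 \<and> (cdot l1 v = 1 \<or> cdot l2 v = 1)"
proof (cases "cdot l v1 = 0")
  case True
  then show ?thesis by (intro exI[of _ v1]) simp
next
  case False
  then show ?thesis by (intro exI[of _ "v2 - (cdot l v2 / cdot l v1) *s v1"]) simp
qed

text \<open>Induction on the number of points still within both bounds for \<open>l1\<close> and
  \<open>l2\<close>. Such a point is beyond the bound of another \<open>l \<in> L\<close>; a shear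
  in \<open>l\<close> pushes it out, together with all points beyond that bound.\<close>

lemma solvable_outside_polyhedron:
  assumes "inj_on a A" "\<And>w. w \<in> A \<Longrightarrow> \<exists>l\<in>L. c l < Re (cdot l (a w))"
  shows "solvable A a L c"
  using assms
proof (induction "card {w \<in> A. Re (cdot l1 (a w)) \<le> c l1 \<and> Re (cdot l2 (a w)) \<le> c l2}" arbitrary: a c rule: less_induct)
  case less
  define bad where "bad a c = {w \<in> A. Re (cdot l1 (a w)) \<le> c l1 \<and> Re (cdot l2 (a w)) \<le> c l2}"
    for a :: "complex \<Rightarrow> complex ^ 'n" and c :: "complex ^ 'n \<Rightarrow> real"
  show ?case
  proof (cases "bad a c = {}")
    case True
    then show ?thesis
      by (intro solvable_outside_product less.prems) (force simp: bad_def)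
  next
    case False
    then obtain w0 where w0: "w0 \<in> bad a c" by blast
    then obtain l where l: "l \<in> L" "c l < Re (cdot l (a w0))"
      using less.prems(2) by (auto simp: bad_def)
    obtain v where v: "cdot l v = 0" "cdot l1 v = 1 \<or> cdot l2 v = 1"
      using exists_escape_direction by blast
    obtain \<delta> where \<delta>: "\<delta> > 0"
      "\<forall>(m, w)\<in>L \<times> A. Re (cdot m (a w)) - c m > 0 \<longrightarrow> Re (cdot m (a w)) - c m > \<delta>"
      using uniform_slack[of "L \<times> A" "\<lambda>(m, w). Re (cdot m (a w)) - c m"] finite_functionals finite_points
      by (auto simp: split_beta)
    have slack: "c m + \<delta> < Re (cdot m (a w))" if "m \<in> L" "w \<in> A" "c m < Re (cdot m (a w))" for m w
      using bspec[OF \<delta>(2), of "(m, w)"] that by simp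
    obtain m1 where m1: "\<And>w. w \<in> A \<Longrightarrow> m1 < Re (cdot l1 (a w))"
      using finite_strict_lower_bound[OF finite_points, of "\<lambda>w. Re (cdot l1 (a w))"] by blast
    obtain m2 where m2: "\<And>w. w \<in> A \<Longrightarrow> m2 < Re (cdot l2 (a w))"
      using finite_strict_lower_bound[OF finite_points, of "\<lambda>w. Re (cdot l2 (a w))"] by blast
    \<comment> \<open>Adding \<open>s\<close> lifts any number above \<open>m1\<close> or
      \<open>m2\<close> past \<open>c l1 + \<delta>\<close> and \<open>c l2 + \<delta>\<close>,
      whichever of the two functionals \<open>v\<close> increases.\<close>
    define s where "s = \<bar>c l1\<bar> + \<bar>c l2\<bar> + \<bar>m1\<bar> + \<bar>m2\<bar> + \<delta>"
    define d where "d w = (if Re (cdot l (a w)) \<le> c l then 0 else of_real s *s v)" for w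
    have moved: "c l1 + \<delta> < Re (cdot l1 (a w + d w)) \<or> c l2 + \<delta> < Re (cdot l2 (a w + d w))"
      if "w \<in> A" "c l < Re (cdot l (a w))" for w
      using v(2) m1[OF that(1)] m2[OF that(1)] that(2) by (auto simp: d_def s_def)
    have inj: "inj_on (\<lambda>w. a w + d w) A"
      by (rule inj_on_shear[OF less.prems(1), of l]) (auto simp: d_def v)
    have "\<exists>m\<in>L. c m + \<delta> < Re (cdot m (a w + d w))" if w: "w \<in> A" for w
    proof (cases "c l < Re (cdot l (a w))")
      case True
      then show ?thesis using moved[OF w] mem by blast
    next
      case False
      then show ?thesis using less.prems(2)[OF w] slack[OF _ w] by (auto simp: d_def)
    qed
    \<comment> \<open>Moved points are no longer bad, \<open>w0\<close> among them; unmoved points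
      that were not bad remain so, because \<delta> is below their slack.\<close>
    moreover have "bad (\<lambda>w. a w + d w) (\<lambda>l. c l + \<delta>) \<subset> bad a c"
    proof
      show "bad (\<lambda>w. a w + d w) (\<lambda>l. c l + \<delta>) \<subseteq> bad a c"
      proof
        fix w assume w: "w \<in> bad (\<lambda>w. a w + d w) (\<lambda>l. c l + \<delta>)"
        then have "w \<in> A" "\<not> c l < Re (cdot l (a w))" using moved[of w] by (auto simp: bad_def)
        then show "w \<in> bad a c"
          using w slack[OF mem(1), of w] slack[OF mem(2), of w] by (force simp: bad_def d_def)
      qed
      show "bad (\<lambda>w. a w + d w) (\<lambda>l. c l + \<delta>) \<noteq> bad a c"
      proof -
        have "w0 \<notin> bad (\<lambda>w. a w + d w) (\<lambda>l. c l + \<delta>)"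
          using w0 moved[OF _ l(2)] unfolding bad_def by force
        then show ?thesis using w0 by blast
      qed
    qed
    then have "card (bad (\<lambda>w. a w + d w) (\<lambda>l. c l + \<delta>)) < card (bad a c)"
      by (rule psubset_card_mono[rotated]) (simp add: bad_def finite_points)
    ultimately have "solvable A (\<lambda>w. a w + d w) L (\<lambda>l. c l + \<delta>)"
      unfolding bad_def by (intro less.hyps inj) auto
    then show ?thesis
      by (rule solvable_shear[OF finite_points finite_functionals l(1) \<delta>(1), rotated -1])
        (auto simp: d_def v)
  qed
qed

end

section \<open>Convex sets and complex hyperplanes\<close>

text \<open>Every real functional is the real part of a complex one, so real separation theorems
  yield complex functionals.\<close>

lemma cdot_cnj: "Re (cdot (\<chi> i. cnj (y $ i)) x) = y \<bullet> x"
  by (simp add: cdot_def inner_vec_def inner_complex_def)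

lemma closed_convex_separation:
  fixes F :: "(complex ^ 'n) set"
  assumes "convex F" "closed F" "p \<notin> F"
  shows "\<exists>l b. (\<forall>x\<in>F. Re (cdot l x) \<le> b) \<and> b < Re (cdot l p)"
proof -
  obtain y b where "y \<bullet> p < b" "\<And>x. x \<in> F \<Longrightarrow> y \<bullet> x > b"
    using separating_hyperplane_closed_point[OF assms] by blast
  then have "(\<forall>x\<in>F. Re (cdot (\<chi> i. cnj ((- y) $ i)) x) \<le> - b) \<and> - b < Re (cdot (\<chi> i. cnj ((- y) $ i)) p)"
    unfolding cdot_cnj by (auto simp: less_imp_le)
  then show ?thesis by blast
qed

lemma subspace_kernel: "vec.subspace {x. cdot l x = 0}"
  by (auto simp: vec.subspace_def)

lemma dim_kernel:
  fixes l :: "complex ^ 'n"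
  assumes "cdot l w \<noteq> 0"
  shows "vec.dim {x. cdot l x = 0} + 1 = CARD('n)"
proof -
  let ?K = "{x. cdot l x = 0}"
  have K: "vec.span ?K = ?K" by (simp add: subspace_kernel)
  have "x \<in> vec.span (insert w ?K)" for x
  proof -
    have "x - (cdot l x / cdot l w) *s w \<in> vec.span ?K" unfolding K using assms by simp
    then show ?thesis unfolding vec.span_insert by blast
  qed
  then have "vec.span (insert w ?K) = UNIV" by blast
  then have "vec.dim (insert w ?K) = CARD('n)"
    by (metis vec.dim_span vec_dim_card)
  then show ?thesis using assms by (simp add: vec.dim_insert K)
qed

lemma complex_hyperplane_kernel:
  assumes "cdot l w \<noteq> 0"
  shows "complex_hyperplane {x. cdot l x = r}"
  unfolding complex_hyperplane_def
proof (intro exI conjI)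
  show "vec.subspace {x. cdot l x = 0}" by (rule subspace_kernel)
  show "vec.dim {x. cdot l x = 0} + 1 = CARD('a)" using assms by (rule dim_kernel)
  show "{x. cdot l x = r} = (\<lambda>v. (r / cdot l w) *s w + v) ` {x. cdot l x = 0}"
  proof
    show "{x. cdot l x = r} \<subseteq> (\<lambda>v. (r / cdot l w) *s w + v) ` {x. cdot l x = 0}"
    proof
      fix x assume "x \<in> {x. cdot l x = r}"
      then show "x \<in> (\<lambda>v. (r / cdot l w) *s w + v) ` {x. cdot l x = 0}"
        using assms by (intro image_eqI[where x="x - (r / cdot l w) *s w"]) auto
    qed
  qed (use assms in auto)
qed

text \<open>Separate the direction space \<open>V\<close> from a point outside. The real part of the
  functional is bounded on \<open>V\<close>, and complex scaling within \<open>V\<close> forces the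
  functional to vanish there; equal dimensions make \<open>V\<close> its kernel.\<close>

lemma complex_hyperplane_obtain_functional:
  fixes H :: "(complex ^ 'n) set"
  assumes "complex_hyperplane H"
  obtains l w r where "cdot l w = 1" "H = {x. cdot l x = r}"
proof -
  obtain a V where V: "vec.subspace V" "vec.dim V + 1 = CARD('n)" and H: "H = (\<lambda>v. a + v) ` V"
    using assms unfolding complex_hyperplane_def by blast
  have scale: "s *s x \<in> V" if "x \<in> V" for s x using V(1) that by (rule vec.subspace_scale)
  have "V \<noteq> UNIV" using V(2) by (metis Suc_eq_plus1 n_not_Suc_n vec_dim_card)
  then obtain p where p: "p \<notin> V" by blast
  have real: "of_real t *s x = t *\<^sub>R x" for t and x :: "complex ^ 'n"
    unfolding vec_eq_iff vector_smult_component vector_scaleR_component by (simp add: scaleR_conv_of_real)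
  have sub: "subspace V"
    unfolding subspace_def real[symmetric] using V(1) by (auto simp: vec.subspace_def)
  obtain l b where l: "\<And>x. x \<in> V \<Longrightarrow> Re (cdot l x) \<le> b" "b < Re (cdot l p)"
    using closed_convex_separation[OF subspace_imp_convex[OF sub] closed_subspace[OF sub] p] by blast
  have zero: "cdot l x = 0" if "x \<in> V" for x
  proof (rule ccontr)
    assume nz: "cdot l x \<noteq> 0"
    have "Re (cdot l ((of_real (b + 1) / cdot l x) *s x)) \<le> b"
      using scale[OF that] by (rule l(1))
    then show False using nz by simp
  qed
  have "0 \<in> V" using V(1) by (rule vec.subspace_0)
  then have lp: "cdot l p \<noteq> 0" using l(1)[of 0] l(2) by auto
  have "V = {x. cdot l x = 0}"
    using zero dim_kernel[OF lp] V by (intro vec.subspace_dim_equal subspace_kernel) auto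
  then have "H = {x. cdot l x = cdot l a}"
  proof -
    have "x \<in> H" if "cdot l x = cdot l a" for x
      unfolding H \<open>V = _\<close> using that by (intro image_eqI[where x="x - a"]) auto
    then show ?thesis unfolding H \<open>V = _\<close> by auto
  qed
  then show thesis
    using that[of l "(1 / cdot l p) *s p" "cdot l a"] lp by simp
qed

text \<open>A half space containing \<open>F\<close> but not \<open>x + v\<close> would have a
  functional whose real part increases along \<open>v\<close>. It is unbounded on the real line
  through \<open>r *s w\<close> in direction \<open>v\<close>, which lies in the hyperplane and so
  in \<open>F\<close>.\<close>

lemma closed_convex_add_kernel:
  fixes F :: "(complex ^ 'n) set"
  assumes "convex F" "closed F" and H: "{x. cdot l x = r} \<subseteq> F" and l: "cdot l w = 1"
    and x: "x \<in> F" and v: "cdot l v = 0"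
  shows "x + v \<in> F"
proof (rule ccontr)
  assume "x + v \<notin> F"
  then obtain m b where m: "\<And>y. y \<in> F \<Longrightarrow> Re (cdot m y) \<le> b" "b < Re (cdot m (x + v))"
    using closed_convex_separation[OF assms(1,2)] by blast
  have mv: "Re (cdot m v) > 0" using m(1)[OF x] m(2) by simp
  define t where "t = (b - Re (cdot m (r *s w)) + 1) / Re (cdot m v)"
  have "r *s w + of_real t *s v \<in> F" using H l v by auto
  then have "Re (cdot m (r *s w)) + t * Re (cdot m v) \<le> b"
    using m(1)[of "r *s w + of_real t *s v"] by simp
  then show False using mv by (simp add: t_def)
qed

text \<open>The hyperplane parallel to the kernel of \<open>l1\<close> through
  \<open>x0 \<in> F\<close> contains some \<open>y\<close> outside \<open>F\<close>. A functional
  separating \<open>y\<close> from \<open>F\<close> is nonzero on \<open>y - x0\<close>, where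
  \<open>l1\<close> vanishes, so the two are independent.\<close>

lemma exists_independent_bounded_functionals:
  fixes F :: "(complex ^ 'n) set"
  assumes F: "convex F" "closed F" "F \<noteq> UNIV" "F \<noteq> {}"
    and no: "\<not> (\<exists>H. complex_hyperplane H \<and> H \<subseteq> F)"
  obtains l1 l2 v1 v2 b1 b2 where
    "cdot l1 v1 = 1" "cdot l1 v2 = 0" "cdot l2 v1 = 0" "cdot l2 v2 = 1"
    "\<And>x. x \<in> F \<Longrightarrow> Re (cdot l1 x) \<le> b1" "\<And>x. x \<in> F \<Longrightarrow> Re (cdot l2 x) \<le> b2"
proof -
  obtain x0 where x0: "x0 \<in> F" using F(4) by blast
  obtain p where "p \<notin> F" using F(3) by blast
  then obtain l1 b1 where l1: "\<And>x. x \<in> F \<Longrightarrow> Re (cdot l1 x) \<le> b1" "b1 < Re (cdot l1 p)"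
    using closed_convex_separation[OF F(1,2)] by blast
  define q where "q = p - x0"
  have q: "cdot l1 q \<noteq> 0" using l1(1)[OF x0] l1(2) by (auto simp: q_def)
  have "\<not> {x. cdot l1 x = cdot l1 x0} \<subseteq> F"
    using no complex_hyperplane_kernel[OF q] by blast
  then obtain y where y: "cdot l1 y = cdot l1 x0" "y \<notin> F" by blast
  then obtain l2 b2 where l2: "\<And>x. x \<in> F \<Longrightarrow> Re (cdot l2 x) \<le> b2" "b2 < Re (cdot l2 y)"
    using closed_convex_separation[OF F(1,2)] by blast
  define u where "u = y - x0"
  define v2 where "v2 = (1 / cdot l2 u) *s u"
  define w where "w = (1 / cdot l1 q) *s q"
  define v1 where "v1 = w - cdot l2 w *s v2"
  have "cdot l1 u = 0" "cdot l2 u \<noteq> 0" using y(1) l2(1)[OF x0] l2(2) by (auto simp: u_def)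
  then have v2: "cdot l1 v2 = 0" "cdot l2 v2 = 1" unfolding v2_def by simp_all
  have w: "cdot l1 w = 1" using q by (simp add: w_def)
  show thesis by (rule that[of l1 v1 v2 l2 b1 b2]) (use v2 w l1 l2 in \<open>simp_all add: v1_def\<close>)
qed

section \<open>Existence of the interpolating embeddings and the equivalence\<close>

lemma convex_complement_embedding:
  fixes F :: "(complex ^ 'n) set"
  assumes F: "convex F" "closed F" "F \<noteq> UNIV"
    and no: "\<not> (\<exists>H. complex_hyperplane H \<and> H \<subseteq> F)"
    and n: "CARD('n) \<ge> 2" and A: "finite A" "inj_on a A" and a: "\<And>w. w \<in> A \<Longrightarrow> a w \<notin> F"
  shows "\<exists>\<phi>. proper_holomorphic_embedding \<phi> \<and> (\<forall>w\<in>A. \<phi> w = a w) \<and> range \<phi> \<subseteq> - F"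
proof (cases "F = {}")
  case True
  obtain i j :: 'n where ij: "i \<noteq> j"
    using n by (metis One_nat_def card_2_iff' card_le_Suc0_iff_eq finite not_less_eq_eq numeral_2_eq_2 UNIV_I)
  have "axis i 1 $ i = (1 :: complex)" "axis j 1 $ j = (1 :: complex)"
    "axis i 1 $ j = (0 :: complex)" "axis j 1 $ i = (0 :: complex)"
    using ij by (simp_all add: axis_def)
  then interpret independent_functionals "axis i 1" "axis j 1" "axis i 1" "axis j 1" A "{axis i 1, axis j 1}"
    by unfold_locales (use A in simp_all)
  \<comment> \<open>There is nothing to avoid, so any polyhedron that misses the points will
    do.\<close>
  obtain c where "\<And>w. w \<in> A \<Longrightarrow> c < Re (a w $ i)"
    using finite_strict_lower_bound[OF A(1), of "\<lambda>w. Re (a w $ i)"] by blast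
  then have "solvable A a {axis i 1, axis j 1} (\<lambda>_. c)"
    by (intro solvable_outside_polyhedron A(2)) auto
  then show ?thesis unfolding solvable_def True by blast
next
  case False
  obtain l1 l2 v1 v2 b1 b2 where l:
    "cdot l1 v1 = 1" "cdot l1 v2 = 0" "cdot l2 v1 = 0" "cdot l2 v2 = 1"
    "\<And>x. x \<in> F \<Longrightarrow> Re (cdot l1 x) \<le> b1" "\<And>x. x \<in> F \<Longrightarrow> Re (cdot l2 x) \<le> b2"
    using exists_independent_bounded_functionals[OF F False no] by metis
  have "\<forall>w. \<exists>m b. w \<in> A \<longrightarrow> (\<forall>x\<in>F. Re (cdot m x) \<le> b) \<and> b < Re (cdot m (a w))"
    using closed_convex_separation[OF F(1,2)] a by blast
  then obtain m b where m: "\<And>w x. w \<in> A \<Longrightarrow> x \<in> F \<Longrightarrow> Re (cdot (m w) x) \<le> b w"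
      "\<And>w. w \<in> A \<Longrightarrow> b w < Re (cdot (m w) (a w))"
    by metis
  define L where "L = insert l1 (insert l2 (m ` A))"
  \<comment> \<open>The bounds \<open>b w\<close> belong to points, but one functional may serve
    several points; the support function of \<open>F\<close> depends on the functional only.\<close>
  define c where "c l = (SUP x\<in>F. Re (cdot l x))" for l
  interpret independent_functionals l1 l2 v1 v2 A L
    by unfold_locales (use A l in \<open>auto simp: L_def\<close>)
  have "\<exists>l\<in>L. c l < Re (cdot l (a w))" if w: "w \<in> A" for w
  proof (intro bexI)
    have "c (m w) \<le> b w" unfolding c_def using False m(1)[OF w] by (rule cSUP_least)
    then show "c (m w) < Re (cdot (m w) (a w))" using m(2)[OF w] by linarith
  qed (use w in \<open>simp add: L_def\<close>)
  then have "solvable A a L c" by (rule solvable_outside_polyhedron[OF A(2)])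
  then obtain \<phi> where \<phi>: "proper_holomorphic_embedding \<phi>" "\<forall>w\<in>A. \<phi> w = a w"
      "\<And>z. \<exists>l\<in>L. c l < Re (cdot l (\<phi> z))"
    unfolding solvable_def by blast
  have le: "Re (cdot l x) \<le> c l" if "l \<in> L" "x \<in> F" for l x
  proof -
    have "\<exists>M. \<forall>x\<in>F. Re (cdot l x) \<le> M" using that(1) l(5,6) m(1) unfolding L_def by blast
    then have "bdd_above ((\<lambda>x. Re (cdot l x)) ` F)" by (auto simp: bdd_above_def)
    then show ?thesis unfolding c_def using that(2) by (intro cSUP_upper)
  qed
  have "\<phi> z \<notin> F" for z using \<phi>(3)[of z] le by (meson not_le)
  then show ?thesis using \<phi>(1,2) by blast
qed

lemma complex_hyperplane_complement_embedding:
  fixes F :: "(complex ^ 'n) set"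
  assumes "complex_hyperplane F"
    and n: "CARD('n) \<ge> 2" and A: "finite A" "inj_on a A" and a: "\<And>w. w \<in> A \<Longrightarrow> a w \<notin> F"
  shows "\<exists>\<phi>. proper_holomorphic_embedding \<phi> \<and> (\<forall>w\<in>A. \<phi> w = a w) \<and> range \<phi> \<subseteq> - F"
proof -
  obtain l w r where l: "cdot l w = 1" and F: "F = {x. cdot l x = r}"
    using complex_hyperplane_obtain_functional[OF assms(1)] by blast
  obtain i where i: "l $ i \<noteq> 0"
  proof -
    have "l \<noteq> 0" using l by auto
    then show thesis using that by (auto simp: vec_eq_iff)
  qed
  obtain j where j: "j \<noteq> i"
    using n by (metis One_nat_def card_le_Suc0_iff_eq finite not_less_eq_eq numeral_2_eq_2)
  \<comment> \<open>A nonzero kernel vector of \<open>l\<close>, available since there is a second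
    coordinate.\<close>
  define k where "k = axis j 1 - (l $ j / l $ i) *s axis i 1"
  have "k $ j = 1" using j by (simp add: k_def axis_def)
  then have "k \<noteq> 0" by auto
  moreover have "cdot l k = 0" using i by (simp add: k_def)
  ultimately show ?thesis
    using hyperplane_complement_embedding[OF A _ l, of r k] a unfolding F by blast
qed

theorem proposition1:
  fixes F :: "(complex ^ 'n) set"
  assumes "CARD('n) \<ge> 2"
    and "convex F" and "closed F" and "F \<noteq> UNIV"
  defines "cond_i \<equiv>
    complex_hyperplane F \<or> \<not> (\<exists>H. complex_hyperplane H \<and> H \<subseteq> F)"
  defines "cond_ii \<equiv>
    (\<forall>(k::nat) (\<alpha> :: nat \<Rightarrow> complex) (a :: nat \<Rightarrow> complex ^ 'n).
       k \<ge> 1 \<and> inj_on \<alpha> {1..k} \<and> inj_on a {1..k} \<and> a ` {1..k} \<subseteq> - F \<longrightarrow>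
       (\<exists>\<phi>. proper_holomorphic_embedding \<phi> \<and> (\<forall>j\<in>{1..k}. \<phi> (\<alpha> j) = a j) \<and> range \<phi> \<subseteq> - F))"
  defines "cond_iii \<equiv>
    (\<forall>(\<alpha>1::complex) (\<alpha>2::complex) (a1 :: complex ^ 'n) (a2 :: complex ^ 'n).
       \<alpha>1 \<noteq> \<alpha>2 \<and> a1 \<noteq> a2 \<and> a1 \<in> - F \<and> a2 \<in> - F \<longrightarrow>
       (\<exists>\<phi>. proper_holomorphic_embedding \<phi> \<and> \<phi> \<alpha>1 = a1 \<and> \<phi> \<alpha>2 = a2 \<and> range \<phi> \<subseteq> - F))"
  shows "(cond_i \<longleftrightarrow> cond_ii) \<and> (cond_ii \<longleftrightarrow> cond_iii)"
proof -
  have "cond_ii" if "cond_i"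
    unfolding cond_ii_def
  proof (intro allI impI, elim conjE)
    fix k :: nat and \<alpha> :: "nat \<Rightarrow> complex" and a :: "nat \<Rightarrow> complex ^ 'n"
    assume \<alpha>: "inj_on \<alpha> {1..k}" and a: "inj_on a {1..k}" "a ` {1..k} \<subseteq> - F"
    define a' where "a' w = a (inv_into {1..k} \<alpha> w)" for w
    have a': "a' (\<alpha> j) = a j" if "j \<in> {1..k}" for j
      using that \<alpha> by (simp add: a'_def)
    have "inj_on (a' \<circ> \<alpha>) {1..k}"
      using a(1) a' inj_on_cong[of "{1..k}" "a' \<circ> \<alpha>" a] by simp
    then have "inj_on a' (\<alpha> ` {1..k})" by (rule inj_on_imageI)
    moreover have "a' w \<notin> F" if "w \<in> \<alpha> ` {1..k}" for w
      using that a' a(2) by auto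
    ultimately have "\<exists>\<phi>. proper_holomorphic_embedding \<phi> \<and> (\<forall>w\<in>\<alpha> ` {1..k}. \<phi> w = a' w) \<and> range \<phi> \<subseteq> - F"
      using \<open>cond_i\<close> complex_hyperplane_complement_embedding[of F "\<alpha> ` {1..k}" a']
        convex_complement_embedding[of F "\<alpha> ` {1..k}" a'] assms(1-4)
      unfolding cond_i_def by blast
    then show "\<exists>\<phi>. proper_holomorphic_embedding \<phi> \<and> (\<forall>j\<in>{1..k}. \<phi> (\<alpha> j) = a j) \<and> range \<phi> \<subseteq> - F"
      using a' by (metis imageI)
  qed
  moreover have "cond_iii" if "cond_ii"
    unfolding cond_iii_def
  proof (intro allI impI, elim conjE)
    fix \<alpha>1 \<alpha>2 :: complex and a1 a2 :: "complex ^ 'n"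
    assume *: "\<alpha>1 \<noteq> \<alpha>2" "a1 \<noteq> a2" "a1 \<in> - F" "a2 \<in> - F"
    have 12: "{1..2} = {1, 2 :: nat}" by auto
    show "\<exists>\<phi>. proper_holomorphic_embedding \<phi> \<and> \<phi> \<alpha>1 = a1 \<and> \<phi> \<alpha>2 = a2 \<and> range \<phi> \<subseteq> - F"
      using that[unfolded cond_ii_def, rule_format, of 2 "\<lambda>j. if j = 1 then \<alpha>1 else \<alpha>2" "\<lambda>j. if j = 1 then a1 else a2"] *
      unfolding 12 by (auto simp: inj_on_def)
  qed
  moreover have "cond_i" if "cond_iii"
  proof (rule ccontr)
    assume "\<not> cond_i"
    then obtain H where nF: "\<not> complex_hyperplane F" and H: "complex_hyperplane H" "H \<subseteq> F"
      unfolding cond_i_def by blast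
    obtain l w r where l: "cdot l w = 1" and Hl: "H = {x. cdot l x = r}"
      using complex_hyperplane_obtain_functional[OF H(1)] by blast
    \<comment> \<open>Thus \<open>F\<close> is a union of fibres of \<open>l\<close>, and a curve
      avoiding \<open>F\<close> omits the value of \<open>l\<close> at each point of
      \<open>F\<close>.\<close>
    have inv: "y \<in> F" if "x \<in> F" "cdot l y = cdot l x" for x y
      using closed_convex_add_kernel[OF assms(2,3) H(2)[unfolded Hl] l that(1), of "y - x"] that(2) by simp
    obtain x where x: "x \<in> F" "cdot l x \<noteq> r"
    proof -
      have "F \<noteq> H" using nF H(1) by blast
      then show thesis using that H(2) Hl by blast
    qed
    obtain a1 where a1: "a1 \<notin> F" using assms(4) by blast
    \<comment> \<open>The complement of \<open>F\<close> is open, so a small step along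
      \<open>w\<close> gives a second point there with a different value of
      \<open>l\<close>.\<close>
    have "((\<lambda>t. a1 + of_real t *s w) \<longlongrightarrow> a1 + of_real 0 *s w) (at_right 0)"
      unfolding vector_scalar_mult_def by (intro tendsto_intros)
    then have "eventually (\<lambda>t. a1 + of_real t *s w \<in> - F) (at_right 0)"
      by (rule topological_tendstoD) (use assms(3) a1 in auto)
    then have "eventually (\<lambda>t. a1 + of_real t *s w \<in> - F \<and> t > 0) (at_right 0)"
      using eventually_at_right_less[of "0::real"] by eventually_elim auto
    then obtain t :: real where t: "a1 + of_real t *s w \<in> - F" "t > 0"
      using eventually_happens'[OF trivial_limit_at_right_real] by blast
    define a2 where "a2 = a1 + of_real t *s w"
    have l12: "cdot l a1 \<noteq> cdot l a2" using t l by (simp add: a2_def)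
    then have "a1 \<noteq> a2" by auto
    then obtain \<phi> where \<phi>: "proper_holomorphic_embedding \<phi>" "\<phi> 0 = a1" "\<phi> 1 = a2" "range \<phi> \<subseteq> - F"
      using \<open>cond_iii\<close>[unfolded cond_iii_def, rule_format, of 0 1 a1 a2] a1 t by (auto simp: a2_def)
    have "(\<lambda>z. cdot l (\<phi> z)) holomorphic_on UNIV"
      using \<phi>(1) by (intro holomorphic_on_cdot) (simp add: proper_holomorphic_embedding_def)
    moreover have "range (\<lambda>z. cdot l (\<phi> z)) \<inter> {cdot l x, r} = {}"
      using \<phi>(4) inv[OF x(1)] H(2) unfolding Hl by blast
    ultimately obtain s where "(\<lambda>z. cdot l (\<phi> z)) = (\<lambda>_. s)"
      using little_Picard x(2) by metis
    then have "cdot l (\<phi> 0) = cdot l (\<phi> 1)" by metis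
    then show False using l12 \<phi>(2,3) by simp
  qed
  ultimately show ?thesis by blast
qed

end
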